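(* Let $(V,d) = (V_x,d_x)_{x \in X}$ be a Borel field of separable pseudometric spaces. Assume that $(V',d') = (V'_x,d'_x)_{x \in X}$ is any family of separation-completions for $(V_x,d_x)$ with corresponding maps $\gamma_x : V_x \to V'_x$, and let $\gamma : V \to V'$ be the map given by $\gamma = (\gamma_x)_{x\in X}$. 1. $V'$ admits a unique standard Borel structure such that the map $\pi : V' \to X$, the map $\gamma : V \to V'$ and the metric $d' : V' \times_\pi V' \to [0,+\infty)$ are Borel. In this way, $V'$ is a Borel field of Polish spaces. 2. Whenever $\varphi_n : X \to V$ is a dense sequence of Borel sections, the $\sigma$-algebra on $V'$ defined in 1 is the smallest $\sigma$-algebra such that the maps $\pi : V' \to X$ and $V' \to [0,+\infty) : v \mapsto d'(v,\gamma(\varphi_n(\pi(v))))$, $n\in\mathbb{N}$, are measurable. 3. Let $Y$ be a measurable space and $W = (W_x)_{x \in X}$ a Borel field of Polish spaces. Assume that $\pi : Y \to X$ is a measurable map and $C : Y \times_\pi V' \to W$ is any map such that $\pi(C(y,v)) = \pi(y)$ for all $(y,v)\in Y\times_\pi V'$ and such that the restrictions $C_y : V'_{\pi(y)} \to W_{\pi(y)} : v \mapsto C(y,v)$ are continuous for all $y \in Y$. Then $C$ is measurable if and only if the map $Y \times_\pi V \to W : (y,v) \mapsto C(y,\gamma(v))$ is measurable.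
   Context: Conventions. A standard Borel space is a measurable space isomorphic to a Borel subset of a Polish space. Product spaces carry the product $\sigma$-algebra and subsets the restricted $\sigma$-algebra. For a family of sets $V = (V_x)_{x\in X}$, the symbol $V$ also denotes the disjoint union of the $V_x$, and $\pi : V \to X$ is the map with $\pi(v) = x$ for $v \in V_x$. For sets $Y, V$ with maps $\pi$ to $X$, $Y \times_\pi V = \{(y,v) \in Y \times V \mid \pi(y)=\pi(v)\}$. A section is a map $\varphi : X \to V$ with $\varphi(x)\in V_x$ for all $x$. A sequence of Borel sections $\varphi_n : X \to V$ is dense if $\{\varphi_n(x) \mid n\in\mathbb{N}\}$ is dense in $V_x$ for every $x\in X$. A pseudometric on a set satisfies all axioms of a (finite-valued) metric except that $d(v,w)=0$ need not imply $v=w$. A separation-completion of a pseudometric space $(V,d)$ is a complete metric space $(V',d')$ together with a map $\gamma:V\to V'$ such that $\gamma(V)$ is dense in $V'$ and $d'(\gamma(v),\gamma(w))=d(v,w)$ for all $v,w\in V$. A Borel field of separable pseudometric spaces consists of a standard Borel space $X$, a family $(V,d)=(V_x,d_x)_{x\in X}$ of pseudometric spaces and a standard Borel structure on $V$ such that $\pi : V\to X$ and $d : V\times_\pi V\to[0,+\infty)$ are Borel and such that there exists a dense sequence of Borel sections $X\to V$. A Borel field of Polish spaces consists of a standard Borel space $X$, a family $V=(V_x)_{x\in X}$ of Polish spaces and a standard Borel structure on $V$ such that: (1) $\pi : V\to X$ is Borel; (2) there is a Borel map $d : V\times_\pi V\to[0,+\infty)$ whose restriction to each $V_x\times V_x$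 is a separable complete metric inducing the topology of $V_x$; (3) there is a dense sequence of Borel sections $X\to V$. *)

theory Defs
  imports "HOL-Analysis.Analysis"
begin

definition polish_topology :: "'a topology \<Rightarrow> bool" where
  "polish_topology T \<longleftrightarrow> separable_space T \<and> completely_metrizable_space T"

definition borel_of_topology :: "'a topology \<Rightarrow> 'a measure" where
  "borel_of_topology T = sigma (topspace T) {U. openin T U}"

text \<open>Measures stand for measurable spaces throughout; the measure component is ignored.\<close>

definition measurable_isomorphic :: "'a measure \<Rightarrow> 'b measure \<Rightarrow> bool" where
  "measurable_isomorphic M N \<longleftrightarrow>
    (\<exists>f g. f \<in> M \<rightarrow>\<^sub>M N \<and> g \<in> N \<rightarrow>\<^sub>M M \<and>
      (\<forall>x\<in>space M. g (f x) = x) \<and> (\<forall>y\<in>space N. f (g y) = y))"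

text \<open>HOL cannot quantify over types inside a formula, so the ambient Polish space is an
  arbitrary Polish topology on an arbitrary subset (its \<open>topspace\<close>) of the type
  \<open>nat \<Rightarrow> real\<close>. This loses nothing: a Polish space has at most continuum many points, hence is
  homeomorphic to one of this form.\<close>

definition standard_borel :: "'a measure \<Rightarrow> bool" where
  "standard_borel M \<longleftrightarrow>
    (\<exists>(T :: (nat \<Rightarrow> real) topology) B. polish_topology T \<and> B \<in> sets (borel_of_topology T) \<and>
      measurable_isomorphic M (restrict_space (borel_of_topology T) B))"

text \<open>The disjoint union of a family \<open>(V x)\<close> over \<open>space X\<close> is \<open>SIGMA x:space X. V x\<close>, with
  projection \<open>fst\<close>; a structure on it is a measurable space with this underlying set.\<close>

definition fibre_product ::
    "('y \<Rightarrow> 'x) \<Rightarrow> 'y measure \<Rightarrow> ('v \<Rightarrow> 'x) \<Rightarrow> 'v measure \<Rightarrow> ('y \<times> 'v) measure" where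
  "fibre_product p Y q V = restrict_space (Y \<Otimes>\<^sub>M V) {(y, v). p y = q v}"

text \<open>A fibrewise distance as one function on \<open>V \<times>\<^sub>\<pi> V\<close>.\<close>

definition fibre_dist :: "('x \<Rightarrow> 'v \<Rightarrow> 'v \<Rightarrow> real) \<Rightarrow> ('x \<times> 'v) \<times> ('x \<times> 'v) \<Rightarrow> real" where
  "fibre_dist d = (\<lambda>(v, w). d (fst v) (snd v) (snd w))"

text \<open>A section is given by its fibre components; as a map into the disjoint union it is
  \<open>\<lambda>x. (x, \<phi> x)\<close>.\<close>

definition borel_section ::
    "'x measure \<Rightarrow> ('x \<Rightarrow> 'v set) \<Rightarrow> ('x \<times> 'v) measure \<Rightarrow> ('x \<Rightarrow> 'v) \<Rightarrow> bool" where
  "borel_section X V M \<phi> \<longleftrightarrow> (\<forall>x\<in>space X. \<phi> x \<in> V x) \<and> (\<lambda>x. (x, \<phi> x)) \<in> X \<rightarrow>\<^sub>M M"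

definition pseudometric_on :: "'a set \<Rightarrow> ('a \<Rightarrow> 'a \<Rightarrow> real) \<Rightarrow> bool" where
  "pseudometric_on S d \<longleftrightarrow>
    (\<forall>v\<in>S. d v v = 0) \<and>
    (\<forall>v\<in>S. \<forall>w\<in>S. 0 \<le> d v w \<and> d v w = d w v) \<and>
    (\<forall>u\<in>S. \<forall>v\<in>S. \<forall>w\<in>S. d u w \<le> d u v + d v w)"

definition separation_completion ::
    "'a set \<Rightarrow> ('a \<Rightarrow> 'a \<Rightarrow> real) \<Rightarrow> 'b metric \<Rightarrow> ('a \<Rightarrow> 'b) \<Rightarrow> bool" where
  "separation_completion S d S' \<gamma> \<longleftrightarrow>
    mcomplete_of S' \<and> \<gamma> \<in> S \<rightarrow> mspace S' \<and>
    mtopology_of S' closure_of (\<gamma> ` S) = mspace S' \<and>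
    (\<forall>v\<in>S. \<forall>w\<in>S. mdist S' (\<gamma> v) (\<gamma> w) = d v w)"

definition pseudometric_dense_sections ::
    "'x measure \<Rightarrow> ('x \<Rightarrow> 'v set) \<Rightarrow> ('x \<Rightarrow> 'v \<Rightarrow> 'v \<Rightarrow> real) \<Rightarrow> ('x \<times> 'v) measure \<Rightarrow>
      (nat \<Rightarrow> 'x \<Rightarrow> 'v) \<Rightarrow> bool" where
  "pseudometric_dense_sections X V d M \<phi> \<longleftrightarrow>
    (\<forall>n. borel_section X V M (\<phi> n)) \<and>
    (\<forall>x\<in>space X. \<forall>v\<in>V x. \<forall>\<epsilon>>0. \<exists>n. d x v (\<phi> n x) < \<epsilon>)"

definition topological_dense_sections ::
    "'x measure \<Rightarrow> ('x \<Rightarrow> 'v topology) \<Rightarrow> ('x \<times> 'v) measure \<Rightarrow> (nat \<Rightarrow> 'x \<Rightarrow> 'v) \<Rightarrow> bool" where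
  "topological_dense_sections X T M \<phi> \<longleftrightarrow>
    (\<forall>n. borel_section X (\<lambda>x. topspace (T x)) M (\<phi> n)) \<and>
    (\<forall>x\<in>space X. T x closure_of (range (\<lambda>n. \<phi> n x)) = topspace (T x))"

definition borel_field_pseudometric ::
    "'x measure \<Rightarrow> ('x \<Rightarrow> 'v set) \<Rightarrow> ('x \<Rightarrow> 'v \<Rightarrow> 'v \<Rightarrow> real) \<Rightarrow> ('x \<times> 'v) measure \<Rightarrow> bool" where
  "borel_field_pseudometric X V d M \<longleftrightarrow>
    standard_borel X \<and>
    (\<forall>x\<in>space X. pseudometric_on (V x) (d x)) \<and>
    space M = (SIGMA x:space X. V x) \<and> standard_borel M \<and>
    fst \<in> M \<rightarrow>\<^sub>M X \<and>
    fibre_dist d \<in> borel_measurable (fibre_product fst M fst M) \<and>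
    (\<exists>\<phi>. pseudometric_dense_sections X V d M \<phi>)"

definition borel_field_polish ::
    "'x measure \<Rightarrow> ('x \<Rightarrow> 'v topology) \<Rightarrow> ('x \<times> 'v) measure \<Rightarrow> bool" where
  "borel_field_polish X T M \<longleftrightarrow>
    standard_borel X \<and>
    (\<forall>x\<in>space X. polish_topology (T x)) \<and>
    space M = (SIGMA x:space X. topspace (T x)) \<and> standard_borel M \<and>
    fst \<in> M \<rightarrow>\<^sub>M X \<and>
    (\<exists>D :: 'x \<Rightarrow> 'v metric.
      fibre_dist (\<lambda>x. mdist (D x)) \<in> borel_measurable (fibre_product fst M fst M) \<and>
      (\<forall>x\<in>space X. mtopology_of (D x) = T x \<and> mcomplete_of (D x) \<and>
        separable_space (mtopology_of (D x)))) \<and>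
    (\<exists>\<phi>. topological_dense_sections X T M \<phi>)"

definition total_map :: "('x \<Rightarrow> 'v \<Rightarrow> 'u) \<Rightarrow> 'x \<times> 'v \<Rightarrow> 'x \<times> 'u" where
  "total_map \<gamma> = (\<lambda>(x, v). (x, \<gamma> x v))"

definition completion_structure ::
    "'x measure \<Rightarrow> ('x \<times> 'v) measure \<Rightarrow> ('x \<Rightarrow> 'u metric) \<Rightarrow> ('x \<Rightarrow> 'v \<Rightarrow> 'u) \<Rightarrow>
      ('x \<times> 'u) measure \<Rightarrow> bool" where
  "completion_structure X M V' \<gamma> M' \<longleftrightarrow>
    space M' = (SIGMA x:space X. mspace (V' x)) \<and> standard_borel M' \<and>
    fst \<in> M' \<rightarrow>\<^sub>M X \<and>
    total_map \<gamma> \<in> M \<rightarrow>\<^sub>M M' \<and>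
    fibre_dist (\<lambda>x. mdist (V' x)) \<in> borel_measurable (fibre_product fst M' fst M')"

definition smallest_sigma_algebra :: "('a measure \<Rightarrow> bool) \<Rightarrow> 'a measure \<Rightarrow> bool" where
  "smallest_sigma_algebra P M \<longleftrightarrow>
    P M \<and> (\<forall>N. space N = space M \<and> P N \<longrightarrow> sets M \<subseteq> sets N)"

end

theory Submission
  imports Defs
begin

text \<open>Let \<open>\<phi>\<^sub>n\<close> be a dense sequence of sections. A point \<open>v\<close> of the fibre of \<open>V'\<close> over \<open>x\<close> is determined by
  the sequence of distances \<open>d'(v, \<gamma>(\<phi>\<^sub>n(x)))\<close>, and by completeness the sequences that occur form a
  Borel set defined by countably many inequalities. Hence \<open>V'\<close> embeds as a Borel subset of
  \<open>X \<times> \<real>\<^sup>\<nat>\<close>, and the induced \<open>\<sigma>\<close>-algebra is standard Borel and is the smallest one making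
  \<open>\<pi>\<close> and these distance functions measurable. Any other structure as in the first part contains it, and
  nested standard Borel structures coincide by Lusin's separation theorem. The third part applies the same
  description to \<open>W\<close>, so that only the measurability of fibrewise continuous real functions remains;
  these are limits of their values along the dense sections.\<close>

section \<open>Analytic sets and Lusin separation\<close>

text \<open>Two kinds of structure have to be handled differently. The constructed one is a pullback
  along the distance code, so its inverse code is measurable for free and standardness is
  elementary. A competing structure on \<open>V'\<close>, or the given one on \<open>W\<close>, is
  known only abstractly: all that can be seen is that it contains the distance algebra, and the
  reverse inclusion is what needs analytic sets. Distances to the points
  \<open>\<gamma>(\<phi> n x)\<close> are the right coordinates because the fibres share no ambient
  space, and because \<gamma> is isometric: every quantity whose measurability in \<open>x\<close>
  is needed, such as the distance between two section values, is already a distance in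
  \<open>V\<close>. The structure is built from one dense sequence. Its independence of that
  sequence, needed for the second part, is not computed by hand: it follows from uniqueness, since
  the algebra of any other sequence must coincide with it. Standardness is stated through arbitrary
  Polish topologies on subsets of \<open>nat \<Rightarrow> real\<close>, so spaces are transported
  to Borel subsets of the type itself, where the class-based theory of analytic sets
  applies.\<close>

text \<open>Codes run over a closed subset of Baire space rather than all of it. The empty set is
  then covered, and a closed condition on codes can be imposed without a new
  parametrisation.\<close>

definition analytic_set :: "'a::topological_space set \<Rightarrow> bool" where
  "analytic_set S \<longleftrightarrow>
    (\<exists>F (g :: (nat \<Rightarrow> nat) \<Rightarrow> 'a). closed F \<and> continuous_on F g \<and> S = g ` F)"

text \<open>A point is coded by a rapidly converging sequence of indices into a countable dense set.
  The limit map is continuous because it is a uniform limit of the maps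
  \<open>\<alpha> \<mapsto> q (\<alpha> n)\<close>, each depending on one discrete
  coordinate.\<close>

lemma analytic_set_UNIV:
  "analytic_set (UNIV :: 'a::{complete_space, second_countable_topology} set)"
proof -
  obtain Q :: "'a set" where Q: "countable Q" "\<And>U. open U \<Longrightarrow> U \<noteq> {} \<Longrightarrow> \<exists>q\<in>Q. q \<in> U"
    by (rule countable_dense_setE) blast
  have "Q \<noteq> {}"
    using Q(2)[of UNIV] by auto
  define q where "q = from_nat_into Q"
  have q_dense: "\<exists>n. dist (q n) x < e" if "e > 0" for x e
  proof -
    have "x \<in> ball x e"
      using that by simp
    then have "\<exists>p\<in>Q. p \<in> ball x e"
      by (intro Q(2)) auto
    then obtain p where "p \<in> Q" "p \<in> ball x e" ..
    then show ?thesis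
      using from_nat_into_surj[OF Q(1), of p] by (auto simp: dist_commute q_def)
  qed
  \<comment> \<open>The fixed geometric rate gives uniform convergence on \<open>F\<close>; the
    non-strict inequality makes \<open>F\<close> closed.\<close>
  define F :: "(nat \<Rightarrow> nat) set" where
    "F = {\<alpha>. \<forall>n. dist (q (\<alpha> n)) (q (\<alpha> (Suc n))) \<le> (1/2) ^ n}"
  have cont_q: "continuous_on A (\<lambda>\<alpha>. q (\<alpha> n))" for A n
    by (rule continuous_on_compose2[of UNIV q])
      (auto intro: continuous_on_subset[OF continuous_on_product_coordinates])
  have "closed F"
    unfolding F_def by (intro closed_Collect_all closed_Collect_le continuous_intros cont_q)
  have close: "dist (q (\<alpha> m)) (q (\<alpha> n)) \<le> 2 * (1/2) ^ m" if "\<alpha> \<in> F" "m \<le> n" for \<alpha> m n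
  proof -
    have "dist (q (\<alpha> m)) (q (\<alpha> n)) \<le> 2 * (1/2) ^ m - 2 * (1/2) ^ n"
      using \<open>m \<le> n\<close>
    proof (induction n rule: dec_induct)
      case (step n)
      have "dist (q (\<alpha> m)) (q (\<alpha> (Suc n)))
          \<le> dist (q (\<alpha> m)) (q (\<alpha> n)) + dist (q (\<alpha> n)) (q (\<alpha> (Suc n)))"
        by (rule dist_triangle)
      also have "\<dots> \<le> 2 * (1/2) ^ m - 2 * (1/2) ^ n + (1/2) ^ n"
        using step.IH \<open>\<alpha> \<in> F\<close> by (intro add_mono) (auto simp: F_def)
      finally show ?case
        by simp
    qed simp
    also have "\<dots> \<le> 2 * (1/2) ^ m"
      by simp
    finally show ?thesis .
  qed
  have conv: "convergent (\<lambda>n. q (\<alpha> n))" if "\<alpha> \<in> F" for \<alpha>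
  proof (rule Cauchy_convergent, rule metric_CauchyI)
    fix e :: real
    assume "e > 0"
    then obtain m where m: "(1/2) ^ m < e / 4"
      using real_arch_pow_inv[of "e / 4" "1/2"] by auto
    have "dist (q (\<alpha> i)) (q (\<alpha> j)) < e" if "i \<ge> m" "j \<ge> m" for i j
      using close[OF \<open>\<alpha> \<in> F\<close> that(1)] close[OF \<open>\<alpha> \<in> F\<close> that(2)] m
        dist_triangle3[of "q (\<alpha> i)" "q (\<alpha> j)" "q (\<alpha> m)"] by linarith
    then show "\<exists>M. \<forall>i\<ge>M. \<forall>j\<ge>M. dist (q (\<alpha> i)) (q (\<alpha> j)) < e"
      by blast
  qed
  define g where "g = (\<lambda>\<alpha>. lim (\<lambda>n. q (\<alpha> n)))"
  have g: "(\<lambda>n. q (\<alpha> n)) \<longlonglongrightarrow> g \<alpha>" if "\<alpha> \<in> F" for \<alpha>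
    using conv[OF that] by (simp add: convergent_LIMSEQ_iff g_def)
  have g_close: "dist (q (\<alpha> m)) (g \<alpha>) \<le> 2 * (1/2) ^ m" if "\<alpha> \<in> F" for \<alpha> m
  proof (rule tendsto_upperbound)
    show "(\<lambda>n. dist (q (\<alpha> m)) (q (\<alpha> n))) \<longlonglongrightarrow> dist (q (\<alpha> m)) (g \<alpha>)"
      by (intro tendsto_intros g that)
    show "\<forall>\<^sub>F n in sequentially. dist (q (\<alpha> m)) (q (\<alpha> n)) \<le> 2 * (1/2) ^ m"
      using close[OF that] eventually_sequentially by blast
  qed simp
  have "uniform_limit F (\<lambda>n \<alpha>. q (\<alpha> n)) g sequentially"
  proof (rule uniform_limitI)
    fix e :: real
    assume "e > 0"
    then obtain m where m: "(1/2) ^ m < e / 2"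
      using real_arch_pow_inv[of "e / 2" "1/2"] by auto
    have "dist (q (\<alpha> n)) (g \<alpha>) < e" if "n \<ge> m" "\<alpha> \<in> F" for n \<alpha>
    proof -
      have "(1/2) ^ n \<le> (1/2 :: real) ^ m"
        using that(1) by (intro power_decreasing) auto
      then show ?thesis
        using g_close[OF that(2), of n] m by linarith
    qed
    then show "\<forall>\<^sub>F n in sequentially. \<forall>\<alpha>\<in>F. dist (q (\<alpha> n)) (g \<alpha>) < e"
      using eventually_sequentially by blast
  qed
  then have "continuous_on F g"
    using cont_q by (intro uniform_limit_theorem[where F = sequentially] always_eventually) auto
  moreover have "x \<in> g ` F" for x
  proof -
    \<comment> \<open>Half the allowed rate: consecutive terms then differ by less than
      \<open>(1/2)^n / 2 + (1/2)^(n+1) / 2\<close>, which is at most \<open>(1/2)^n\<close>.\<close>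
    have "\<exists>k. dist (q k) x < (1/2) ^ n / 2" for n
      by (rule q_dense) simp
    then obtain \<alpha> where \<alpha>: "\<And>n. dist (q (\<alpha> n)) x < (1/2) ^ n / 2"
      by metis
    have "\<alpha> \<in> F"
      unfolding F_def
    proof clarify
      fix n
      have "(1/2) ^ Suc n / 2 \<le> (1/2 :: real) ^ n / 2"
        by simp
      then show "dist (q (\<alpha> n)) (q (\<alpha> (Suc n))) \<le> (1/2) ^ n"
        using \<alpha>[of n] \<alpha>[of "Suc n"] dist_triangle2[of "q (\<alpha> n)" "q (\<alpha> (Suc n))" x]
        by linarith
    qed
    have "(\<lambda>n. q (\<alpha> n)) \<longlonglongrightarrow> x"
    proof (rule metric_tendsto_imp_tendsto[where f = "\<lambda>n. (1/2 :: real) ^ n" and a = 0])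
      show "(\<lambda>n. (1/2 :: real) ^ n) \<longlonglongrightarrow> 0"
        by (rule LIMSEQ_power_zero) simp
      have "dist (q (\<alpha> n)) x \<le> dist ((1/2 :: real) ^ n) 0" for n
        using \<alpha>[of n] zero_le_power[of "1/2 :: real" n] by (simp add: dist_real_def del: zero_le_power)
      then show "\<forall>\<^sub>F n in sequentially. dist (q (\<alpha> n)) x \<le> dist ((1/2 :: real) ^ n) 0"
        by simp
    qed
    then have "x = g \<alpha>"
      using g[OF \<open>\<alpha> \<in> F\<close>] LIMSEQ_unique by blast
    then show ?thesis
      using \<open>\<alpha> \<in> F\<close> by blast
  qed
  ultimately show ?thesis
    unfolding analytic_set_def using \<open>closed F\<close> by blast
qed

lemma analytic_set_Int_closed:
  assumes "analytic_set S" "closed C"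
  shows "analytic_set (S \<inter> C)"
proof -
  obtain F and g :: "(nat \<Rightarrow> nat) \<Rightarrow> 'a" where Fg: "closed F" "continuous_on F g" "S = g ` F"
    using assms(1) unfolding analytic_set_def by blast
  have "closed (F \<inter> g -` C)" "continuous_on (F \<inter> g -` C) g" "S \<inter> C = g ` (F \<inter> g -` C)"
    using Fg assms(2) by (auto intro: continuous_closed_preimage continuous_on_subset)
  then show ?thesis
    unfolding analytic_set_def by blast
qed

lemma analytic_set_continuous_image:
  assumes "analytic_set S" "continuous_on S h"
  shows "analytic_set (h ` S)"
proof -
  obtain F and g :: "(nat \<Rightarrow> nat) \<Rightarrow> 'a" where Fg: "closed F" "continuous_on F g" "S = g ` F"
    using assms(1) unfolding analytic_set_def by blast
  then have "continuous_on F (h \<circ> g)" "h ` S = (h \<circ> g) ` F"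
    using assms(2) by (simp_all add: continuous_on_compose image_comp del: o_apply)
  then show ?thesis
    unfolding analytic_set_def using Fg(1) by blast
qed

text \<open>The first entry of a code selects the set, the remaining entries code a point of it.
  Fixing the first entry is an open condition, so closedness and continuity can be checked on each
  piece separately.\<close>

lemma analytic_set_UN:
  fixes S :: "nat \<Rightarrow> 'a::topological_space set"
  assumes "\<And>n. analytic_set (S n)"
  shows "analytic_set (\<Union>n. S n)"
proof -
  obtain F and g :: "nat \<Rightarrow> (nat \<Rightarrow> nat) \<Rightarrow> 'a"
    where Fg: "\<And>n. closed (F n)" "\<And>n. continuous_on (F n) (g n)" "\<And>n. S n = g n ` F n"
    using assms unfolding analytic_set_def by metis
  define tl where "tl = (\<lambda>(\<alpha> :: nat \<Rightarrow> nat) i. \<alpha> (Suc i))"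
  define D where "D = (\<lambda>n. {\<alpha> :: nat \<Rightarrow> nat. \<alpha> 0 = n})"
  define G where "G = {\<alpha>. tl \<alpha> \<in> F (\<alpha> 0)}"
  define h where "h = (\<lambda>\<alpha>. g (\<alpha> 0) (tl \<alpha>))"
  have cont_tl: "continuous_on A tl" for A
    unfolding tl_def
    by (intro continuous_on_coordinatewise_then_product
        continuous_on_subset[OF continuous_on_product_coordinates]) auto
  have D_vimage: "D n = (\<lambda>\<alpha>. \<alpha> 0) -` {n}" for n
    by (auto simp: D_def)
  have open_D: "open (D n)" for n
    unfolding D_vimage by (rule open_vimage) (auto simp: open_discrete)
  have "open (D n \<inter> tl -` (- F n))" for n
    by (intro open_Int open_D open_vimage) (use Fg(1) cont_tl in auto)
  then have "open (\<Union>n. D n \<inter> tl -` (- F n))"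
    by blast
  moreover have "- G = (\<Union>n. D n \<inter> tl -` (- F n))"
    by (auto simp: G_def D_def)
  ultimately have "closed G"
    by (simp add: closed_def)
  have "continuous_on G h"
    unfolding continuous_on_def
  proof
    fix \<alpha>
    assume "\<alpha> \<in> G"
    have "continuous_on (G \<inter> D (\<alpha> 0)) (\<lambda>\<beta>. g (\<alpha> 0) (tl \<beta>))"
      by (rule continuous_on_compose2[OF Fg(2)[of "\<alpha> 0"] cont_tl]) (auto simp: G_def D_def)
    then have "continuous_on (G \<inter> D (\<alpha> 0)) h"
      by (rule continuous_on_eq) (auto simp: h_def D_def)
    then have "(h \<longlongrightarrow> h \<alpha>) (at \<alpha> within G \<inter> D (\<alpha> 0))"
      using \<open>\<alpha> \<in> G\<close> by (auto simp: continuous_on_def D_def)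
    moreover have "at \<alpha> within G = at \<alpha> within G \<inter> D (\<alpha> 0)"
      by (rule at_within_nhd[where S = "D (\<alpha> 0)"]) (use open_D in \<open>auto simp: D_def\<close>)
    ultimately show "(h \<longlongrightarrow> h \<alpha>) (at \<alpha> within G)"
      by simp
  qed
  moreover have "(\<Union>n. S n) = h ` G"
  proof (intro equalityI subsetI)
    fix x
    assume "x \<in> (\<Union>n. S n)"
    then obtain n \<alpha> where "\<alpha> \<in> F n" "x = g n \<alpha>"
      using Fg(3) by auto
    then have "case_nat n \<alpha> \<in> G" "x = h (case_nat n \<alpha>)"
      by (auto simp: G_def h_def tl_def)
    then show "x \<in> h ` G"
      by blast
  qed (auto simp: G_def h_def Fg(3))
  ultimately show ?thesis
    unfolding analytic_set_def using \<open>closed G\<close> by blast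
qed

lemma analytic_set_INT:
  fixes S :: "nat \<Rightarrow> 'a::metric_space set"
  assumes "\<And>n. analytic_set (S n)"
  shows "analytic_set (\<Inter>n. S n)"
proof -
  obtain F and g :: "nat \<Rightarrow> (nat \<Rightarrow> nat) \<Rightarrow> 'a"
    where Fg: "\<And>n. closed (F n)" "\<And>n. continuous_on (F n) (g n)" "\<And>n. S n = g n ` F n"
    using assms unfolding analytic_set_def by metis
  \<comment> \<open>A point of the intersection is coded by interleaving one code for each \<open>S n\<close>.\<close>
  define row where "row = (\<lambda>n (\<alpha> :: nat \<Rightarrow> nat) i. \<alpha> (prod_encode (n, i)))"
  have cont_row: "continuous_on A (row n)" for A n
    unfolding row_def
    by (intro continuous_on_coordinatewise_then_product
        continuous_on_subset[OF continuous_on_product_coordinates]) auto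
  define G where "G = (\<Inter>n. row n -` F n)"
  have "closed G"
    unfolding G_def by (intro closed_INT ballI closed_vimage Fg(1) cont_row)
  have cont: "continuous_on G (\<lambda>\<alpha>. g n (row n \<alpha>))" for n
    by (rule continuous_on_compose2[OF Fg(2)[of n] cont_row]) (auto simp: G_def)
  \<comment> \<open>The rows must all code the same point. Writing this as vanishing distances makes
    it a closed condition on codes.\<close>
  define H where "H = (\<Inter>n. {\<alpha> \<in> G. dist (g n (row n \<alpha>)) (g 0 (row 0 \<alpha>)) = 0})"
  have "closed H"
    unfolding H_def
    by (intro closed_INT ballI continuous_closed_preimage_constant continuous_intros cont \<open>closed G\<close>)
  moreover have "continuous_on H (\<lambda>\<alpha>. g 0 (row 0 \<alpha>))"
    using cont by (rule continuous_on_subset) (auto simp: H_def)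
  moreover have "(\<Inter>n. S n) = (\<lambda>\<alpha>. g 0 (row 0 \<alpha>)) ` H"
  proof (intro equalityI subsetI)
    fix x
    assume "x \<in> (\<Inter>n. S n)"
    then have "\<forall>n. \<exists>\<alpha>. \<alpha> \<in> F n \<and> x = g n \<alpha>"
      using Fg(3) by auto
    then obtain \<beta> where \<beta>: "\<And>n. \<beta> n \<in> F n" "\<And>n. x = g n (\<beta> n)"
      by metis
    define \<alpha> where "\<alpha> = (\<lambda>k. case prod_decode k of (n, i) \<Rightarrow> \<beta> n i)"
    have row: "row n \<alpha> = \<beta> n" for n
      by (simp add: row_def \<alpha>_def)
    have "\<alpha> \<in> H"
      using \<beta>(1) \<beta>(2)[symmetric] by (auto simp: H_def G_def row)
    then show "x \<in> (\<lambda>\<alpha>. g 0 (row 0 \<alpha>)) ` H"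
      using \<beta>(2)[of 0] row[of 0] by force
  next
    fix x
    assume "x \<in> (\<lambda>\<alpha>. g 0 (row 0 \<alpha>)) ` H"
    then obtain \<alpha> where \<alpha>: "\<alpha> \<in> H" "x = g 0 (row 0 \<alpha>)"
      by blast
    then have "row n \<alpha> \<in> F n \<and> x = g n (row n \<alpha>)" for n
      unfolding H_def G_def by (metis (mono_tags, lifting) INT_iff UNIV_I dist_eq_0_iff mem_Collect_eq vimageE)
    then show "x \<in> (\<Inter>n. S n)"
      using Fg(3) by auto
  qed
  ultimately show ?thesis
    unfolding analytic_set_def by blast
qed

text \<open>Analyticity does not pass to complements, so the induction carries a set together with
  its complement. For the generators, the complement of a closed set is a countable union of closed
  sets by metrizability.\<close>

lemma analytic_set_borel:
  fixes A :: "'a::{complete_space, second_countable_topology} set"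
  assumes "A \<in> sets borel"
  shows "analytic_set A"
proof -
  have closed: "analytic_set C" if "closed C" for C :: "'a set"
    using analytic_set_Int_closed[OF analytic_set_UNIV that] by simp
  have compl: "analytic_set (- C)" if "closed C" for C :: "'a set"
  proof -
    have "fsigma_in euclidean (- C)"
      using that by (intro open_imp_fsigma_in metrizable_space_euclidean) (simp add: open_Compl)
    then obtain D where "\<And>n. closed (D n)" "- C = (\<Union>n::nat. D n)"
      unfolding fsigma_in_ascending closed_closedin by metis
    then show ?thesis
      using analytic_set_UN[of D] closed by simp
  qed
  have "A \<in> sigma_sets UNIV {C. closed C}"
    using assms by (simp add: borel_eq_closed)
  then have "analytic_set A \<and> analytic_set (- A)"
  proof (induction rule: sigma_sets.induct)
    case Empty
    then show ?case
      using closed[of "{}"] closed[of UNIV] by simp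
  next
    case (Union a)
    then show ?case
      using analytic_set_UN[of a] analytic_set_INT[of "\<lambda>n. - a n"] by simp
  qed (auto simp: closed compl Compl_eq_Diff_UNIV[symmetric])
  then show ?thesis
    by simp
qed

text \<open>The image is the projection of the graph, which is Borel.\<close>

lemma analytic_set_borel_image:
  fixes f :: "'a::{complete_space, second_countable_topology}
      \<Rightarrow> 'b::{complete_space, second_countable_topology}"
  assumes "A \<in> sets borel" "f \<in> borel_measurable (restrict_space borel A)"
  shows "analytic_set (f ` A)"
proof -
  let ?N = "restrict_space (borel :: ('a \<times> 'b) measure) (A \<times> UNIV)"
  have fst_snd: "fst \<in> ?N \<rightarrow>\<^sub>M borel" "snd \<in> ?N \<rightarrow>\<^sub>M borel"
    by (intro measurable_restrict_space1 borel_measurable_continuous_onI continuous_intros)+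
  have "fst \<in> ?N \<rightarrow>\<^sub>M restrict_space borel A"
    using fst_snd(1) by (intro measurable_restrict_space2) (auto simp: space_restrict_space)
  then have f_fst: "(\<lambda>p. f (fst p)) \<in> borel_measurable ?N"
    using assms(2) by (rule measurable_compose)
  have "(\<lambda>p. dist (f (fst p)) (snd p)) \<in> borel_measurable ?N"
    using f_fst fst_snd(2) by (rule borel_measurable_dist)
  then have "(\<lambda>p. dist (f (fst p)) (snd p)) -` {0} \<inter> space ?N \<in> sets ?N"
    by (rule measurable_sets) simp
  moreover have "(\<lambda>p. dist (f (fst p)) (snd p)) -` {0} \<inter> space ?N = {p. fst p \<in> A \<and> f (fst p) = snd p}"
    by (auto simp: space_restrict_space)
  moreover have "A \<times> UNIV \<in> sets (borel :: ('a \<times> 'b) measure)"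
  proof -
    have "(fst :: 'a \<times> 'b \<Rightarrow> 'a) \<in> borel_measurable borel"
      by (intro borel_measurable_continuous_onI continuous_intros)
    then have "fst -` A \<inter> space (borel :: ('a \<times> 'b) measure) \<in> sets borel"
      using assms(1) by (rule measurable_sets)
    moreover have "fst -` A \<inter> space (borel :: ('a \<times> 'b) measure) = A \<times> UNIV"
      by auto
    ultimately show ?thesis
      by simp
  qed
  ultimately have "{p. fst p \<in> A \<and> f (fst p) = snd p} \<in> sets borel"
    by (simp add: sets_restrict_space_iff)
  then have "analytic_set {p. fst p \<in> A \<and> f (fst p) = snd p}"
    by (rule analytic_set_borel)
  then have "analytic_set (snd ` {p. fst p \<in> A \<and> f (fst p) = snd p})"
    by (rule analytic_set_continuous_image) (intro continuous_intros)
  moreover have "snd ` {p. fst p \<in> A \<and> f (fst p) = snd p} = f ` A"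
    by (auto simp: image_iff)
  ultimately show ?thesis
    by simp
qed

section \<open>Separation of disjoint analytic sets by Borel sets\<close>

lemma open_contains_cylinder:
  fixes \<alpha> :: "nat \<Rightarrow> 'a::topological_space"
  assumes "open U" "\<alpha> \<in> U"
  obtains n where "{\<beta>. \<forall>i<n. \<beta> i = \<alpha> i} \<subseteq> U"
proof -
  obtain W where W: "finite {i. W i \<noteq> UNIV}" "\<alpha> \<in> Pi\<^sub>E UNIV W" "Pi\<^sub>E UNIV W \<subseteq> U"
  proof -
    have "openin (product_topology (\<lambda>i. euclidean) UNIV) U"
      using assms(1) by (simp only: open_fun_def)
    from openin_product_topology_alt[THEN iffD1, OF this, THEN bspec, OF assms(2)] that
    show thesis
      by auto
  qed
  obtain n where n: "\<And>i. W i \<noteq> UNIV \<Longrightarrow> i < n"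
    using W(1) unfolding finite_nat_set_iff_bounded by blast
  have "{\<beta>. \<forall>i<n. \<beta> i = \<alpha> i} \<subseteq> Pi\<^sub>E UNIV W"
  proof
    fix \<beta>
    assume \<beta>: "\<beta> \<in> {\<beta>. \<forall>i<n. \<beta> i = \<alpha> i}"
    have "\<beta> i \<in> W i" for i
    proof (cases "W i = UNIV")
      case False
      then have "\<beta> i = \<alpha> i"
        using \<beta> n by simp
      then show ?thesis
        using W(2) by (simp add: PiE_iff)
    qed simp
    then show "\<beta> \<in> Pi\<^sub>E UNIV W"
      by (simp add: PiE_iff)
  qed
  then have "{\<beta>. \<forall>i<n. \<beta> i = \<alpha> i} \<subseteq> U"
    using W(3) by (rule subset_trans)
  then show thesis
    by (rule that)
qed

definition borel_separated :: "'a::topological_space set \<Rightarrow> 'a set \<Rightarrow> bool" where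
  "borel_separated S T \<longleftrightarrow> (\<exists>C\<in>sets borel. S \<subseteq> C \<and> T \<inter> C = {})"

text \<open>The separating set is a union of intersections of the given separators. It is used in
  contrapositive form: if two unions cannot be separated, then some pair of their pieces cannot be
  separated either.\<close>

lemma borel_separated_UN:
  fixes S T :: "nat \<Rightarrow> 'a::topological_space set"
  assumes "\<And>i j. borel_separated (S i) (T j)"
  shows "borel_separated (\<Union>i. S i) (\<Union>j. T j)"
proof -
  obtain C where C: "\<And>i j. C i j \<in> sets borel" "\<And>i j. S i \<subseteq> C i j" "\<And>i j. T j \<inter> C i j = {}"
    using assms unfolding borel_separated_def by metis
  show ?thesis
    unfolding borel_separated_def
  proof (rule bexI)
    show "(\<Union>i. \<Inter>j. C i j) \<in> sets borel"
      using C(1) by auto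
    show "(\<Union>i. S i) \<subseteq> (\<Union>i. \<Inter>j. C i j) \<and> (\<Union>j. T j) \<inter> (\<Union>i. \<Inter>j. C i j) = {}"
    proof (intro conjI equals0I UN_least)
      show "S i \<subseteq> (\<Union>i. \<Inter>j. C i j)" for i
        using C(2)[of i] by blast
      show False if x: "x \<in> (\<Union>j. T j) \<inter> (\<Union>i. \<Inter>j. C i j)" for x
      proof -
        obtain i j where "x \<in> T j" "x \<in> C i j"
          using x by blast
        then show False
          using C(3)[of j i] by blast
      qed
    qed
  qed
qed

text \<open>If separation fails, it still fails after suitably lengthening the prefixes of both
  codes by one entry. Repeating this yields two infinite codes whose values are distinct points.
  Disjoint neighbourhoods of these points contain the images of all sufficiently small cylinders,
  and an open neighbourhood is itself a Borel separator, a contradiction.\<close>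

theorem Lusin_separation:
  fixes S T :: "'a::t2_space set"
  assumes "analytic_set S" "analytic_set T" "S \<inter> T = {}"
  shows "borel_separated S T"
proof (rule ccontr)
  assume not_sep: "\<not> borel_separated S T"
  obtain F and g :: "(nat \<Rightarrow> nat) \<Rightarrow> 'a" where F: "closed F" "continuous_on F g" "S = g ` F"
    using assms(1) unfolding analytic_set_def by blast
  obtain G and h :: "(nat \<Rightarrow> nat) \<Rightarrow> 'a" where G: "closed G" "continuous_on G h" "T = h ` G"
    using assms(2) unfolding analytic_set_def by blast
  define cyl where "cyl = (\<lambda>xs. {\<alpha> :: nat \<Rightarrow> nat. \<forall>i<length xs. \<alpha> i = xs ! i})"
  have cyl_split: "cyl xs = (\<Union>k. cyl (xs @ [k]))" for xs
  proof (intro equalityI subsetI)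
    show "\<alpha> \<in> (\<Union>k. cyl (xs @ [k]))" if "\<alpha> \<in> cyl xs" for \<alpha>
      using that by (intro UN_I[of "\<alpha> (length xs)"]) (auto simp: cyl_def nth_append less_Suc_eq)
    show "\<alpha> \<in> cyl xs" if "\<alpha> \<in> (\<Union>k. cyl (xs @ [k]))" for \<alpha>
      using that by (auto simp: cyl_def nth_append)
  qed
  define bad where "bad = (\<lambda>(xs, ys). \<not> borel_separated (g ` (F \<inter> cyl xs)) (h ` (G \<inter> cyl ys)))"
  have step': "\<exists>i j. bad (xs @ [i], ys @ [j])" if "bad (xs, ys)" for xs ys
  proof (rule ccontr)
    assume "\<nexists>i j. bad (xs @ [i], ys @ [j])"
    then have "borel_separated (\<Union>i. g ` (F \<inter> cyl (xs @ [i]))) (\<Union>j. h ` (G \<inter> cyl (ys @ [j])))"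
      by (intro borel_separated_UN) (simp add: bad_def)
    moreover have "(\<Union>i. g ` (F \<inter> cyl (xs @ [i]))) = g ` (F \<inter> cyl xs)"
      "(\<Union>j. h ` (G \<inter> cyl (ys @ [j]))) = h ` (G \<inter> cyl ys)"
      by (simp_all only: cyl_split[of xs] cyl_split[of ys] Int_UN_distrib image_UN)
    ultimately have "borel_separated (g ` (F \<inter> cyl xs)) (h ` (G \<inter> cyl ys))"
      by (simp only:)
    then show False
      using that by (simp add: bad_def)
  qed
  have step: "\<exists>r. bad r \<and> (\<exists>i j. r = (fst q @ [i], snd q @ [j]))" if "bad q" for q
  proof -
    have "bad (fst q, snd q)"
      using that by simp
    then obtain i j where "bad (fst q @ [i], snd q @ [j])"
      using step' by blast
    then show ?thesis
      by (intro exI[of _ "(fst q @ [i], snd q @ [j])"]) auto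
  qed
  have "bad ([], [])"
    using not_sep by (simp add: bad_def cyl_def F(3) G(3))
  \<comment> \<open>Pinning the start to empty lists gives both prefixes at stage \<open>n\<close>
    length exactly \<open>n\<close>.\<close>
  have "\<exists>p. \<forall>n. (bad (p n) \<and> (n = 0 \<longrightarrow> p n = ([], []))) \<and>
      (\<exists>i j. p (Suc n) = (fst (p n) @ [i], snd (p n) @ [j]))"
  proof (rule dependent_nat_choice)
    show "\<exists>q. bad q \<and> ((0::nat) = 0 \<longrightarrow> q = ([], []))"
      using \<open>bad ([], [])\<close> by blast
    show "\<exists>r. (bad r \<and> (Suc n = 0 \<longrightarrow> r = ([], []))) \<and> (\<exists>i j. r = (fst q @ [i], snd q @ [j]))"
      if "bad q \<and> (n = 0 \<longrightarrow> q = ([], []))" for q and n :: nat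
      using step[of q] that by simp
  qed
  then obtain p where p: "\<And>n. bad (p n) \<and> (n = 0 \<longrightarrow> p n = ([], []))"
    "\<And>n. \<exists>i j. p (Suc n) = (fst (p n) @ [i], snd (p n) @ [j])"
    by auto
  obtain a b where ab: "\<And>n. p (Suc n) = (fst (p n) @ [a n], snd (p n) @ [b n])"
    using p(2) by metis
  have p_eq: "p n = (map a [0..<n], map b [0..<n])" for n
    by (induction n) (use p(1)[of 0] ab in auto)
  have cyl_map: "cyl (map f [0..<n]) = {\<beta>. \<forall>i<n. \<beta> i = f i}" for f n
    by (auto simp: cyl_def)
  have bad: "\<not> borel_separated (g ` (F \<inter> cyl (map a [0..<n]))) (h ` (G \<inter> cyl (map b [0..<n])))" for n
    using p(1)[of n] unfolding p_eq bad_def by simp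
  have mono: "borel_separated P' Q'" if "borel_separated P Q" "P' \<subseteq> P" "Q' \<subseteq> Q" for P P' Q Q' :: "'a set"
    using that unfolding borel_separated_def by (meson disjoint_iff subset_iff)
  have triv: "borel_separated {} Q" "borel_separated Q {}" for Q :: "'a set"
    unfolding borel_separated_def by (rule bexI[of _ "{}"], simp_all, rule bexI[of _ UNIV], simp_all)
  \<comment> \<open>Closedness of \<open>F\<close> enters here: outside \<open>F\<close> a whole
    cylinder would miss it, leaving an empty image, which is separated from anything.\<close>
  have "a \<in> F"
  proof (rule ccontr)
    assume "a \<notin> F"
    then obtain n where "{\<beta>. \<forall>i<n. \<beta> i = a i} \<subseteq> - F"
      using open_contains_cylinder[OF open_Compl[OF F(1)], of a] by (metis ComplI)
    then have "F \<inter> cyl (map a [0..<n]) = {}"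
      unfolding cyl_map by blast
    then show False
      using bad[of n] triv by simp
  qed
  moreover have "b \<in> G"
  proof (rule ccontr)
    assume "b \<notin> G"
    then obtain n where "{\<beta>. \<forall>i<n. \<beta> i = b i} \<subseteq> - G"
      using open_contains_cylinder[OF open_Compl[OF G(1)], of b] by (metis ComplI)
    then have "G \<inter> cyl (map b [0..<n]) = {}"
      unfolding cyl_map by blast
    then show False
      using bad[of n] triv by simp
  qed
  ultimately have "g a \<noteq> h b"
    using assms(3) F(3) G(3) by blast
  then obtain P Q where PQ: "open P" "open Q" "g a \<in> P" "h b \<in> Q" "P \<inter> Q = {}"
    using hausdorff[of "g a" "h b"] by auto
  obtain P' where P': "open P'" "P' \<inter> F = g -` P \<inter> F"
    using F(2) PQ(1) unfolding continuous_on_open_invariant by blast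
  obtain Q' where Q': "open Q'" "Q' \<inter> G = h -` Q \<inter> G"
    using G(2) PQ(2) unfolding continuous_on_open_invariant by blast
  obtain m where m: "{\<beta>. \<forall>i<m. \<beta> i = a i} \<subseteq> P'"
  proof (rule open_contains_cylinder[OF P'(1)])
    show "a \<in> P'"
      using P'(2) \<open>a \<in> F\<close> PQ(3) by auto
  qed
  obtain n where n: "{\<beta>. \<forall>i<n. \<beta> i = b i} \<subseteq> Q'"
  proof (rule open_contains_cylinder[OF Q'(1)])
    show "b \<in> Q'"
      using Q'(2) \<open>b \<in> G\<close> PQ(4) by auto
  qed
  \<comment> \<open>The maximum is taken because non-separation is known only for two prefixes of
    equal length.\<close>
  have "g ` (F \<inter> cyl (map a [0..<max m n])) \<subseteq> P"
  proof
    fix y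
    assume "y \<in> g ` (F \<inter> cyl (map a [0..<max m n]))"
    then obtain \<beta> where \<beta>: "y = g \<beta>" "\<beta> \<in> F" "\<forall>i<max m n. \<beta> i = a i"
      by (auto simp: cyl_map)
    then have "\<beta> \<in> P' \<inter> F"
      using m by auto
    then show "y \<in> P"
      using P'(2) \<beta>(1) by auto
  qed
  moreover have "h ` (G \<inter> cyl (map b [0..<max m n])) \<subseteq> Q"
  proof
    fix y
    assume "y \<in> h ` (G \<inter> cyl (map b [0..<max m n]))"
    then obtain \<beta> where \<beta>: "y = h \<beta>" "\<beta> \<in> G" "\<forall>i<max m n. \<beta> i = b i"
      by (auto simp: cyl_map)
    then have "\<beta> \<in> Q' \<inter> G"
      using n by auto
    then show "y \<in> Q"
      using Q'(2) \<beta>(1) by auto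
  qed
  moreover have "borel_separated P Q"
    unfolding borel_separated_def using PQ by (intro bexI[of _ P]) auto
  ultimately show False
    using mono bad[of "max m n"] by metis
qed

section \<open>Standard Borel spaces\<close>

definition dense_seq :: "'a metric \<Rightarrow> (nat \<Rightarrow> 'a) \<Rightarrow> bool" where
  "dense_seq m q \<longleftrightarrow>
    range q \<subseteq> mspace m \<and> (\<forall>u\<in>mspace m. \<forall>\<epsilon>>0. \<exists>n. mdist m u (q n) < \<epsilon>)"

text \<open>A Frechet-Kuratowski type embedding, with values in the fixed space
  \<open>nat \<Rightarrow> real\<close> whatever the metric space.\<close>

definition dist_seq :: "'a metric \<Rightarrow> (nat \<Rightarrow> 'a) \<Rightarrow> 'a \<Rightarrow> nat \<Rightarrow> real" where
  "dist_seq m q u = (\<lambda>n. mdist m u (q n))"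

lemma dense_seqD:
  assumes "dense_seq m q"
  shows "q n \<in> mspace m" "u \<in> mspace m \<Longrightarrow> 0 < \<epsilon> \<Longrightarrow> \<exists>n. mdist m u (q n) < \<epsilon>"
  using assms unfolding dense_seq_def by (blast, metis)

lemma closure_of_mtopology_of:
  "mtopology_of m closure_of S = {u \<in> mspace m. \<forall>\<epsilon>>0. \<exists>v\<in>S. v \<in> mspace m \<and> mdist m u v < \<epsilon>}"
  unfolding mtopology_of_def Metric_space.metric_closure_of[OF Metric_space_mspace_mdist]
  by (auto simp: Metric_space.in_mball[OF Metric_space_mspace_mdist])

lemma dense_seq_iff_closure_of:
  "dense_seq m q \<longleftrightarrow> range q \<subseteq> mspace m \<and> mtopology_of m closure_of (range q) = mspace m"
  unfolding dense_seq_def closure_of_mtopology_of by blast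

lemma dense_seq_separable_space:
  assumes "dense_seq m q"
  shows "separable_space (mtopology_of m)"
  using assms unfolding dense_seq_iff_closure_of separable_space_def
  by (intro exI[of _ "range q"]) auto

lemma separable_space_dense_seq:
  assumes "separable_space (mtopology_of m)" "mspace m \<noteq> {}"
  obtains q where "dense_seq m q"
proof -
  obtain C where C: "countable C" "C \<subseteq> mspace m" "mtopology_of m closure_of C = mspace m"
    using assms(1) unfolding separable_space_def by auto
  then have "C \<noteq> {}"
    using assms(2) by auto
  then have "range (from_nat_into C) = C"
    using C(1) by (rule range_from_nat_into)
  then have "dense_seq m (from_nat_into C)"
    using C by (simp add: dense_seq_iff_closure_of)
  then show thesis
    by (rule that)
qed

lemma limitin_mtopology_of:
  "limitin (mtopology_of m) s u sequentially \<longleftrightarrow>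
    u \<in> mspace m \<and> (\<forall>\<epsilon>>0. \<exists>N. \<forall>n\<ge>N. s n \<in> mspace m \<and> mdist m (s n) u < \<epsilon>)"
  unfolding mtopology_of_def
  by (rule Metric_space.limit_metric_sequentially[OF Metric_space_mspace_mdist])

text \<open>The bound has the shape in which \<open>dist_profile\<close> delivers it: points chosen
  with \<open>y n < inverse (Suc k)\<close> satisfy it through
  \<open>D i j \<le> y i + y j\<close>.\<close>

lemma mcomplete_of_limit:
  assumes "mcomplete_of m" "range s \<subseteq> mspace m"
    and "\<And>i j :: nat. mdist m (s i) (s j) \<le> inverse (Suc i) + inverse (Suc j)"
  shows "\<exists>u\<in>mspace m. \<forall>\<epsilon>>0. \<exists>N. \<forall>n\<ge>N. mdist m (s n) u < \<epsilon>"
proof -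
  interpret Metric_space "mspace m" "mdist m"
    by simp
  have "MCauchy s"
    unfolding MCauchy_def
  proof (intro conjI allI impI)
    fix \<epsilon> :: real
    assume "\<epsilon> > 0"
    then obtain N where N: "inverse (Suc N) < \<epsilon> / 2"
      using reals_Archimedean[of "\<epsilon> / 2"] by auto
    have "mdist m (s i) (s j) < \<epsilon>" if "N \<le> i" "N \<le> j" for i j
    proof -
      have "inverse (Suc i) \<le> inverse (Suc N)" "inverse (Suc j) \<le> inverse (Suc N)"
        using that by (auto intro: le_imp_inverse_le)
      then show ?thesis
        using assms(3)[of i j] N by linarith
    qed
    then show "\<exists>N. \<forall>n n'. N \<le> n \<longrightarrow> N \<le> n' \<longrightarrow> mdist m (s n) (s n') < \<epsilon>"
      by blast
  qed (use assms(2) in simp)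
  then obtain u where "limitin (mtopology_of m) s u sequentially"
    using assms(1) unfolding mcomplete_of_def mcomplete_def mtopology_of_def by blast
  then show ?thesis
    unfolding limitin_mtopology_of by blast
qed

text \<open>A member of the sequence close to one point is equally close to any other point with the
  same code.\<close>

lemma inj_on_dist_seq:
  assumes "dense_seq m q"
  shows "inj_on (dist_seq m q) (mspace m)"
proof (rule inj_onI)
  fix u v
  assume uv: "u \<in> mspace m" "v \<in> mspace m" "dist_seq m q u = dist_seq m q v"
  have "mdist m u v \<le> \<epsilon>" if "\<epsilon> > 0" for \<epsilon>
  proof -
    obtain n where n: "mdist m u (q n) < \<epsilon> / 2"
      using dense_seqD(2)[OF assms uv(1), of "\<epsilon> / 2"] \<open>\<epsilon> > 0\<close> by auto
    have "mdist m v (q n) = mdist m u (q n)"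
      using uv(3) by (simp add: dist_seq_def fun_eq_iff)
    then show ?thesis
      using mdist_triangle[of u m "q n" v] uv dense_seqD(1)[OF assms] n
      by (simp add: mdist_commute)
  qed
  then have "mdist m u v \<le> 0"
    by (rule field_le_epsilon) simp
  then show "u = v"
    using mdist_nonneg[of m u v] mdist_zero[OF uv(1,2)] by simp
qed

text \<open>In a complete metric space with dense sequence \<open>q\<close>, these are exactly the sequences of
  distances \<open>d(u, q\<^sub>n)\<close> of a point \<open>u\<close>, where \<open>D i j = d(q\<^sub>i, q\<^sub>j)\<close>: the last clause selects a
  Cauchy subsequence of \<open>q\<close>, whose limit is \<open>u\<close>.\<close>

definition dist_profile :: "(nat \<Rightarrow> nat \<Rightarrow> real) \<Rightarrow> (nat \<Rightarrow> real) \<Rightarrow> bool" where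
  "dist_profile D y \<longleftrightarrow>
    (\<forall>i j. \<bar>y i - y j\<bar> \<le> D i j \<and> D i j \<le> y i + y j) \<and> (\<forall>k. \<exists>n. y n < inverse (Suc k))"

lemma range_dist_seq:
  assumes "mcomplete_of m" "dense_seq m q"
  shows "dist_seq m q ` mspace m = {y. dist_profile (\<lambda>i j. mdist m (q i) (q j)) y}"
proof (intro equalityI subsetI)
  note q = dense_seqD(1)[OF assms(2)]
  fix y
  assume "y \<in> dist_seq m q ` mspace m"
  then obtain u where u: "u \<in> mspace m" "\<And>n. y n = mdist m u (q n)"
    by (auto simp: dist_seq_def)
  have "\<exists>n. y n < inverse (Suc k)" for k
    using dense_seqD(2)[OF assms(2) u(1), of "inverse (Suc k)"] u(2) by simp
  moreover have "\<bar>y i - y j\<bar> \<le> mdist m (q i) (q j) \<and> mdist m (q i) (q j) \<le> y i + y j" for i j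
    using mdist_triangle[of u m "q i" "q j"] mdist_triangle[of u m "q j" "q i"]
      mdist_triangle[of "q i" m u "q j"] q u by (simp add: mdist_commute)
  ultimately show "y \<in> {y. dist_profile (\<lambda>i j. mdist m (q i) (q j)) y}"
    by (simp add: dist_profile_def)
next
  note q = dense_seqD(1)[OF assms(2)]
  fix y
  assume "y \<in> {y. dist_profile (\<lambda>i j. mdist m (q i) (q j)) y}"
  then have y: "\<And>i j. \<bar>y i - y j\<bar> \<le> mdist m (q i) (q j)" "\<And>i j. mdist m (q i) (q j) \<le> y i + y j"
    "\<And>k. \<exists>n. y n < inverse (Suc k)"
    by (auto simp: dist_profile_def)
  obtain c where c: "\<And>k. y (c k) < inverse (Suc k)"
    using y(3) by metis
  have "\<exists>u\<in>mspace m. \<forall>\<epsilon>>0. \<exists>N. \<forall>k\<ge>N. mdist m (q (c k)) u < \<epsilon>"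
  proof (rule mcomplete_of_limit[OF assms(1)])
    show "range (\<lambda>k. q (c k)) \<subseteq> mspace m"
      using q by auto
    show "mdist m (q (c i)) (q (c j)) \<le> inverse (Suc i) + inverse (Suc j)" for i j
      using y(2)[of "c i" "c j"] c[of i] c[of j] by linarith
  qed
  then obtain u where u: "u \<in> mspace m" "\<And>\<epsilon>. \<epsilon> > 0 \<Longrightarrow> \<exists>N. \<forall>k\<ge>N. mdist m (q (c k)) u < \<epsilon>"
    by blast
  \<comment> \<open>For large \<open>k\<close> the point \<open>q (c k)\<close> is near
    \<open>u\<close> and \<open>y (c k)\<close> is small. Hence both \<open>y n\<close> and the
    distance from \<open>u\<close> to \<open>q n\<close> are close to the distance from
    \<open>q (c k)\<close> to \<open>q n\<close>, each with error below
    \<open>\<epsilon> / 2\<close>.\<close>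
  have "\<bar>y n - mdist m u (q n)\<bar> \<le> \<epsilon>" if "\<epsilon> > 0" for n \<epsilon>
  proof -
    obtain N where N: "\<And>k. k \<ge> N \<Longrightarrow> mdist m (q (c k)) u < \<epsilon> / 2"
      using u(2)[of "\<epsilon> / 2"] \<open>\<epsilon> > 0\<close> by auto
    obtain K where K: "inverse (Suc K) < \<epsilon> / 2"
      using reals_Archimedean[of "\<epsilon> / 2"] \<open>\<epsilon> > 0\<close> by auto
    define k where "k = max N K"
    have "inverse (Suc k) \<le> inverse (Suc K)"
      by (auto simp: k_def intro: le_imp_inverse_le)
    then have "y (c k) < \<epsilon> / 2"
      using c[of k] K by linarith
    moreover have "mdist m (q (c k)) u < \<epsilon> / 2"
      using N by (simp add: k_def)
    moreover have "mdist m u (q n) \<le> mdist m (q (c k)) u + mdist m (q (c k)) (q n)"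
      "mdist m (q (c k)) (q n) \<le> mdist m (q (c k)) u + mdist m u (q n)"
      using mdist_triangle[of u m "q (c k)" "q n"] mdist_triangle[of "q (c k)" m u "q n"] q u(1)
      by (simp_all add: mdist_commute)
    ultimately show ?thesis
      using y(1)[of n "c k"] y(2)[of "c k" n] y(1)[of "c k" n] by linarith
  qed
  then have "\<bar>y n - mdist m u (q n)\<bar> \<le> 0" for n
    by (rule field_le_epsilon) simp
  then have "y = dist_seq m q u"
    by (simp add: dist_seq_def fun_eq_iff)
  then show "y \<in> dist_seq m q ` mspace m"
    using u(1) by blast
qed

section \<open>Measurable isomorphisms and permanence of standard Borel spaces\<close>

lemma measurable_isomorphicI:
  assumes "f \<in> M \<rightarrow>\<^sub>M N" "g \<in> N \<rightarrow>\<^sub>M M"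
    and "\<And>x. x \<in> space M \<Longrightarrow> g (f x) = x" "\<And>y. y \<in> space N \<Longrightarrow> f (g y) = y"
  shows "measurable_isomorphic M N"
  using assms unfolding measurable_isomorphic_def by blast

lemma measurable_isomorphicE:
  assumes "measurable_isomorphic M N"
  obtains f g where "f \<in> M \<rightarrow>\<^sub>M N" "g \<in> N \<rightarrow>\<^sub>M M"
    "\<forall>x\<in>space M. g (f x) = x" "\<forall>y\<in>space N. f (g y) = y"
  using assms unfolding measurable_isomorphic_def by blast

lemma measurable_isomorphic_trans:
  assumes "measurable_isomorphic L M" "measurable_isomorphic M N"
  shows "measurable_isomorphic L N"
proof -
  obtain f g where fg: "f \<in> L \<rightarrow>\<^sub>M M" "g \<in> M \<rightarrow>\<^sub>M L"
    "\<forall>x\<in>space L. g (f x) = x" "\<forall>y\<in>space M. f (g y) = y"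
    by (rule measurable_isomorphicE[OF assms(1)]) (rule that)
  obtain h k where hk: "h \<in> M \<rightarrow>\<^sub>M N" "k \<in> N \<rightarrow>\<^sub>M M"
    "\<forall>x\<in>space M. k (h x) = x" "\<forall>y\<in>space N. h (k y) = y"
    by (rule measurable_isomorphicE[OF assms(2)]) (rule that)
  show ?thesis
    by (rule measurable_isomorphicI[OF measurable_compose[OF fg(1) hk(1)] measurable_compose[OF hk(2) fg(2)]])
      (simp_all add: fg(3,4) hk(3,4) measurable_space[OF fg(1)] measurable_space[OF hk(2)])
qed

lemma measurable_isomorphic_restrict_space:
  assumes "measurable_isomorphic M N" "S \<in> sets M"
  obtains S' where "S' \<in> sets N" "measurable_isomorphic (restrict_space M S) (restrict_space N S')"
proof -
  obtain f g where fg: "f \<in> M \<rightarrow>\<^sub>M N" "g \<in> N \<rightarrow>\<^sub>M M"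
    "\<forall>x\<in>space M. g (f x) = x" "\<forall>y\<in>space N. f (g y) = y"
    by (rule measurable_isomorphicE[OF assms(1)]) (rule that)
  define S' where "S' = g -` S \<inter> space N"
  have "S \<subseteq> space M"
    using assms(2) by (rule sets.sets_into_space)
  have "f \<in> restrict_space M S \<rightarrow>\<^sub>M restrict_space N S'"
    by (intro measurable_restrict_space2 measurable_restrict_space1 fg(1))
      (use measurable_space[OF fg(1)] fg(3) in \<open>auto simp: space_restrict_space S'_def\<close>)
  moreover have "g \<in> restrict_space N S' \<rightarrow>\<^sub>M restrict_space M S"
    by (intro measurable_restrict_space2 measurable_restrict_space1 fg(2))
      (auto simp: space_restrict_space S'_def)
  ultimately have "measurable_isomorphic (restrict_space M S) (restrict_space N S')"
    by (rule measurable_isomorphicI) (simp_all add: space_restrict_space fg(3,4))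
  moreover have "S' \<in> sets N"
    unfolding S'_def using fg(2) assms(2) by (rule measurable_sets)
  ultimately show thesis
    using that by blast
qed

lemma standard_borel_isomorphic:
  assumes "measurable_isomorphic M N" "standard_borel N"
  shows "standard_borel M"
  using assms measurable_isomorphic_trans unfolding standard_borel_def by blast

lemma standard_borel_restrict_space:
  assumes "standard_borel M" "S \<in> sets M"
  shows "standard_borel (restrict_space M S)"
proof -
  obtain T :: "(nat \<Rightarrow> real) topology" and B
    where T: "polish_topology T" "B \<in> sets (borel_of_topology T)"
      "measurable_isomorphic M (restrict_space (borel_of_topology T) B)"
    using assms(1) unfolding standard_borel_def by blast
  obtain S' where S': "S' \<in> sets (restrict_space (borel_of_topology T) B)"
    "measurable_isomorphic (restrict_space M S) (restrict_space (restrict_space (borel_of_topology T) B) S')"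
    using measurable_isomorphic_restrict_space[OF T(3) assms(2)] by metis
  have "B \<inter> space (borel_of_topology T) = B"
    using sets.sets_into_space[OF T(2)] by blast
  then have S'_B: "S' \<subseteq> B" "S' \<in> sets (borel_of_topology T)"
    using S'(1) T(2) by (simp_all add: sets_restrict_space_iff)
  then have "B \<inter> S' = S'"
    by blast
  moreover have "restrict_space (restrict_space (borel_of_topology T) B) S' =
      restrict_space (borel_of_topology T) (B \<inter> S')"
    using S'_B T(2) by (intro restrict_restrict_space) simp_all
  ultimately have "measurable_isomorphic (restrict_space M S) (restrict_space (borel_of_topology T) S')"
    using S'(2) by simp
  then show ?thesis
    unfolding standard_borel_def using T(1) S'_B(2) by blast
qed

lemma polish_topology_euclidean: "polish_topology (euclidean :: 'a::polish_space topology)"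
proof -
  obtain C :: "'a set" where C: "countable C" "\<And>U. open U \<Longrightarrow> U \<noteq> {} \<Longrightarrow> \<exists>q\<in>C. q \<in> U"
    by (rule countable_dense_setE) blast
  have "closure C = UNIV"
    unfolding closure_def islimpt_def using C(2) by fastforce
  then have "separable_space (euclidean :: 'a topology)"
    unfolding separable_space_def using C(1) by auto
  then show ?thesis
    by (simp add: polish_topology_def completely_metrizable_space_euclidean)
qed

lemma sets_borel_of_topology_euclidean: "sets (borel_of_topology euclidean) = sets borel"
  by (simp add: borel_of_topology_def sets_borel)

lemma standard_borel_borel: "standard_borel (borel :: (nat \<Rightarrow> real) measure)"
proof -
  have [simp]: "space (borel_of_topology (euclidean :: (nat \<Rightarrow> real) topology)) = UNIV"
    by (simp add: borel_of_topology_def)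
  have "sets (restrict_space (borel_of_topology euclidean) UNIV) = sets (borel :: (nat \<Rightarrow> real) measure)"
    by (simp add: sets_restrict_space sets_borel_of_topology_euclidean)
  note eq = this
  have "id \<in> borel \<rightarrow>\<^sub>M restrict_space (borel_of_topology euclidean) (UNIV :: (nat \<Rightarrow> real) set)"
    "id \<in> restrict_space (borel_of_topology euclidean) UNIV \<rightarrow>\<^sub>M (borel :: (nat \<Rightarrow> real) measure)"
    unfolding measurable_cong_sets[OF refl eq] measurable_cong_sets[OF eq refl] id_def
    by (rule measurable_ident_sets[OF refl])+
  then have "measurable_isomorphic (borel :: (nat \<Rightarrow> real) measure)
      (restrict_space (borel_of_topology euclidean) (UNIV :: (nat \<Rightarrow> real) set))"
    by (rule measurable_isomorphicI) simp_all
  then show ?thesis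
    unfolding standard_borel_def using polish_topology_euclidean
    by (intro exI[of _ euclidean] exI[of _ UNIV]) (simp add: sets_borel_of_topology_euclidean)
qed

section \<open>Realising standard Borel spaces as Borel sets of real sequences\<close>

lemma measurable_coordinate: "(\<lambda>y :: nat \<Rightarrow> real. y n) \<in> borel_measurable borel"
  by (intro borel_measurable_continuous_onI) simp

text \<open>All quantifiers in \<open>dist_profile\<close> range over natural numbers, so the
  condition is a countable combination of measurable inequalities. The matrix depends on the base
  point because this is applied to a whole field of metric spaces.\<close>

lemma dist_profile_measurable:
  assumes "\<And>i j. (\<lambda>x. D x i j) \<in> borel_measurable X"
  shows "{p \<in> space (X \<Otimes>\<^sub>M borel). dist_profile (D (fst p)) (snd p)} \<in> sets (X \<Otimes>\<^sub>M borel)"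
proof -
  have [measurable]: "(\<lambda>p. D (fst p) i j) \<in> borel_measurable (X \<Otimes>\<^sub>M borel)" for i j
    by (rule measurable_compose[OF measurable_fst assms])
  have [measurable]: "(\<lambda>p. (snd p :: nat \<Rightarrow> real) i) \<in> borel_measurable (X \<Otimes>\<^sub>M borel)" for i
    by (rule measurable_compose[OF measurable_snd measurable_coordinate])
  show ?thesis
    unfolding dist_profile_def by measurable
qed

lemma space_borel_of_topology: "space (borel_of_topology T) = topspace T"
  unfolding borel_of_topology_def by (intro space_measure_of) (use openin_subset in blast)

lemma sets_borel_of_topology:
  "sets (borel_of_topology T) = sigma_sets (topspace T) {U. openin T U}"
  unfolding borel_of_topology_def by (intro sets_measure_of) (use openin_subset in blast)

text \<open>The distance code is inverted measurably by hand: an open set is a countable union of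
  balls around members of \<open>q\<close>, and a ball around \<open>q n\<close> becomes the
  condition that the \<open>n\<close>-th coordinate be less than its radius. Completeness makes the
  image Borel through \<open>range_dist_seq\<close>.\<close>

lemma borel_of_topology_embedding:
  fixes m :: "'a metric"
  assumes "mcomplete_of m" "dense_seq m q"
  obtains R :: "(nat \<Rightarrow> real) set"
  where "R \<in> sets borel"
    "measurable_isomorphic (borel_of_topology (mtopology_of m)) (restrict_space borel R)"
proof -
  let ?M = "borel_of_topology (mtopology_of m)"
  interpret Metric_space "mspace m" "mdist m"
    by simp
  note q = dense_seqD(1)[OF assms(2)]
  define f where "f = dist_seq m q"
  define R where "R = f ` mspace m"
  define g where "g = the_inv_into (mspace m) f"
  have inj: "inj_on f (mspace m)"
    unfolding f_def by (rule inj_on_dist_seq[OF assms(2)])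
  have gf: "g (f u) = u" if "u \<in> mspace m" for u
    unfolding g_def using inj that by (rule the_inv_into_f_f)
  have fg: "f (g y) = y" "g y \<in> mspace m" if "y \<in> R" for y
    using that gf by (auto simp: R_def)
  have space: "space ?M = mspace m"
    by (simp add: space_borel_of_topology)
  have openM: "U \<in> sets ?M" if "openin mtopology U" for U
    unfolding sets_borel_of_topology mtopology_of_def using that by (intro sigma_sets.Basic) simp
  have R_eq: "R = {y. dist_profile (\<lambda>i j. mdist m (q i) (q j)) y}"
    unfolding R_def f_def by (rule range_dist_seq[OF assms])
  have R: "R \<in> sets borel"
  proof -
    note measurable_coordinate [measurable]
    have "{y \<in> space borel. dist_profile (\<lambda>i j. mdist m (q i) (q j)) y} \<in> sets borel"
      unfolding dist_profile_def by measurable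
    then show ?thesis
      by (simp add: R_eq)
  qed
  have "f \<in> borel_measurable ?M"
  proof (rule measurable_coordinatewise_then_product)
    fix n
    have "{u \<in> space ?M. f u n < a} \<in> sets ?M" for a
    proof -
      have "{u \<in> space ?M. f u n < a} = mball (q n) a"
        using q by (auto simp: space f_def dist_seq_def mdist_commute)
      then show ?thesis
        using openM[OF openin_mball] by simp
    qed
    then show "(\<lambda>u. f u n) \<in> borel_measurable ?M"
      by (simp add: borel_measurable_iff_less)
  qed
  then have "f \<in> ?M \<rightarrow>\<^sub>M restrict_space borel R"
    by (rule measurable_restrict_space2[rotated]) (simp add: R_def space)
  moreover have "g \<in> restrict_space borel R \<rightarrow>\<^sub>M ?M"
    unfolding borel_of_topology_def
  proof (rule measurable_measure_of)
    show "{U. openin (mtopology_of m) U} \<subseteq> Pow (topspace (mtopology_of m))"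
      using openin_subset by blast
    show "g \<in> space (restrict_space borel R) \<rightarrow> topspace (mtopology_of m)"
      using fg by (auto simp: space_restrict_space)
    fix U
    assume "U \<in> {U. openin (mtopology_of m) U}"
    then have U: "openin mtopology U"
      by (simp add: mtopology_of_def)
    \<comment> \<open>With the radius \<open>inverse (Suc k)\<close> below \<open>r / 2\<close> and
      the centre within that radius of \<open>u\<close>, the ball contains \<open>u\<close> and
      stays inside the ball of radius \<open>r\<close> around \<open>u\<close>.\<close>
    have ball: "\<exists>n k. u \<in> mball (q n) (inverse (Suc k)) \<and> mball (q n) (inverse (Suc k)) \<subseteq> U"
      if u_U: "u \<in> U" for u
    proof -
      have u: "u \<in> mspace m"
        using U u_U openin_mtopology by blast
      obtain r where r: "r > 0" "mball u r \<subseteq> U"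
        using U u_U unfolding openin_mtopology by meson
      obtain k where k: "inverse (Suc k) < r / 2"
        using reals_Archimedean[of "r / 2"] r(1) by auto
      obtain n where n: "mdist m u (q n) < inverse (Suc k)"
        using dense_seqD(2)[OF assms(2) u, of "inverse (Suc k)"] by auto
      have "mball (q n) (inverse (Suc k)) \<subseteq> mball u r"
      proof
        fix v
        assume "v \<in> mball (q n) (inverse (Suc k))"
        then have "v \<in> mspace m" "mdist m (q n) v < inverse (Suc k)"
          by simp_all
        then show "v \<in> mball u r"
          using mdist_triangle[OF u q[of n], of v] n k u by (simp del: of_nat_Suc)
      qed
      moreover have "u \<in> mball (q n) (inverse (Suc k))"
        using n u q by (simp add: mdist_commute)
      ultimately show ?thesis
        using r(2) by blast
    qed
    define I where "I = {(n, k). mball (q n) (inverse (Suc k)) \<subseteq> U}"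
    have "g -` U \<inter> R = (\<Union>(n, k)\<in>I. {y \<in> R. y n < inverse (Suc k)})"
    proof (intro equalityI subsetI)
      fix y
      assume y: "y \<in> g -` U \<inter> R"
      then obtain n k where nk: "g y \<in> mball (q n) (inverse (Suc k))" "(n, k) \<in> I"
        using ball[of "g y"] by (auto simp: I_def)
      then have "f (g y) n < inverse (Suc k)"
        by (simp add: f_def dist_seq_def mdist_commute)
      then show "y \<in> (\<Union>(n, k)\<in>I. {y \<in> R. y n < inverse (Suc k)})"
        using y nk(2) fg(1)[of y] by (intro UN_I[of "(n, k)"]) auto
    next
      fix y
      assume "y \<in> (\<Union>(n, k)\<in>I. {y \<in> R. y n < inverse (Suc k)})"
      then obtain n k where nk: "(n, k) \<in> I" "y \<in> R" "y n < inverse (Suc k)"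
        by blast
      then have "f (g y) n < inverse (Suc k)"
        by (simp add: fg(1))
      then have "g y \<in> mball (q n) (inverse (Suc k))"
        using fg(2)[OF nk(2)] q by (simp add: f_def dist_seq_def mdist_commute)
      then show "y \<in> g -` U \<inter> R"
        using nk(1,2) by (auto simp: I_def)
    qed
    also have "\<dots> \<in> sets borel"
    proof (rule sets.countable_UN'')
      show "countable I"
        by simp
      note measurable_coordinate [measurable]
      have "{y \<in> space borel. y n < inverse (Suc k)} \<inter> R \<in> sets borel" for n k
        using R by measurable
      moreover have "{y \<in> space borel. y n < inverse (Suc k)} \<inter> R = {y \<in> R. y n < inverse (Suc k)}" for n k
        by auto
      ultimately show "(case p of (n, k) \<Rightarrow> {y \<in> R. y n < inverse (Suc k)}) \<in> sets borel" for p
        by (cases p) simp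
    qed
    finally have "g -` U \<inter> R \<in> sets borel" .
    then show "g -` U \<inter> space (restrict_space borel R) \<in> sets (restrict_space borel R)"
      using R by (simp add: space_restrict_space sets_restrict_space_iff)
  qed
  ultimately have "measurable_isomorphic ?M (restrict_space borel R)"
    by (rule measurable_isomorphicI) (simp_all add: space space_restrict_space gf fg(1))
  with R show thesis
    by (rule that)
qed

text \<open>Trades the arbitrary Polish topology of the definition for the usual topology on the
  type, which is what the results on analytic sets require.\<close>

lemma standard_borelE:
  assumes "standard_borel M"
  obtains R :: "(nat \<Rightarrow> real) set"
  where "R \<in> sets borel" "measurable_isomorphic M (restrict_space borel R)"
proof -
  obtain T :: "(nat \<Rightarrow> real) topology" and B
    where T: "polish_topology T" "B \<in> sets (borel_of_topology T)"
      "measurable_isomorphic M (restrict_space (borel_of_topology T) B)"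
    using assms unfolding standard_borel_def by blast
  obtain m where m: "mcomplete_of m" "T = mtopology_of m"
    using T(1) unfolding polish_topology_def completely_metrizable_space_def
    by (metis Metric_space.mcomplete_of Metric_space.mtopology_of)
  obtain R :: "(nat \<Rightarrow> real) set" where R: "R \<in> sets borel"
    "measurable_isomorphic (borel_of_topology T) (restrict_space borel R)"
  \<comment> \<open>An empty space has no dense sequence, so it is matched with the empty set
    directly.\<close>
  proof (cases "mspace m = {}")
    case True
    then have "space (borel_of_topology T) = {}"
      by (simp add: space_borel_of_topology m(2))
    then have "measurable_isomorphic (borel_of_topology T) (restrict_space borel ({} :: (nat \<Rightarrow> real) set))"
      by (simp add: measurable_isomorphic_def measurable_empty_iff space_restrict_space)
    then show thesis
      using that[of "{}"] by simp
  next
    case False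
    then obtain q where "dense_seq m q"
      using T(1) separable_space_dense_seq m(2) unfolding polish_topology_def by metis
    then show thesis
      using borel_of_topology_embedding[OF m(1)] m(2) that by metis
  qed
  obtain S where S: "S \<in> sets (restrict_space borel R)"
    "measurable_isomorphic (restrict_space (borel_of_topology T) B)
       (restrict_space (restrict_space borel R) S)"
    using measurable_isomorphic_restrict_space[OF R(2) T(2)] by metis
  have S_R: "S \<in> sets borel" "S \<subseteq> R"
    using S(1) R(1) by (simp_all add: sets_restrict_space_iff)
  then have "restrict_space (restrict_space borel R) S = restrict_space borel (R \<inter> S)"
    using R(1) by (intro restrict_restrict_space) simp_all
  moreover have "R \<inter> S = S"
    using S_R(2) by blast
  ultimately have "restrict_space (restrict_space borel R) S = restrict_space borel S"
    by simp
  with S_R(1) show thesis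
    using that measurable_isomorphic_trans[OF T(3) S(2)] by simp
qed

text \<open>Two sequences interleave into one: the code of the first component goes to the even
  coordinates, the second component to the odd ones.\<close>

lemma standard_borel_pair_borel:
  assumes "standard_borel M"
  shows "standard_borel (M \<Otimes>\<^sub>M (borel :: (nat \<Rightarrow> real) measure))"
proof -
  obtain R :: "(nat \<Rightarrow> real) set" where R: "R \<in> sets borel" "measurable_isomorphic M (restrict_space borel R)"
    using standard_borelE[OF assms] by metis
  obtain f g where fg: "f \<in> M \<rightarrow>\<^sub>M restrict_space borel R" "g \<in> restrict_space borel R \<rightarrow>\<^sub>M M"
    "\<forall>x\<in>space M. g (f x) = x" "\<forall>y\<in>space (restrict_space borel R). f (g y) = y"
    by (rule measurable_isomorphicE[OF R(2)]) (rule that)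
  have f_R: "f x \<in> R" if "x \<in> space M" for x
    using measurable_space[OF fg(1) that] by (simp add: space_restrict_space)
  define evens where "evens = (\<lambda>(z :: nat \<Rightarrow> real) n. z (2 * n))"
  define odds where "odds = (\<lambda>(z :: nat \<Rightarrow> real) n. z (Suc (2 * n)))"
  define merge where "merge = (\<lambda>(a :: nat \<Rightarrow> real) b n. if even n then a (n div 2) else b (n div 2))"
  have merge: "evens (merge a b) = a" "odds (merge a b) = b" "merge (evens z) (odds z) = z" for a b z
    unfolding evens_def odds_def merge_def fun_eq_iff by simp_all
  have [measurable]: "evens \<in> borel_measurable borel" "odds \<in> borel_measurable borel"
    unfolding evens_def odds_def by (rule measurable_coordinatewise_then_product, rule measurable_coordinate)+
  have f_borel: "f \<in> borel_measurable M"
    using fg(1) by (simp add: measurable_restrict_space2_iff)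
  define S where "S = {z. evens z \<in> R}"
  have "evens -` R \<inter> space borel \<in> sets borel"
    by (rule measurable_sets) (use R(1) in measurable)
  then have S: "S \<in> sets borel"
    by (simp add: S_def vimage_def)
  have "(\<lambda>p. merge (f (fst p)) (snd p)) \<in> M \<Otimes>\<^sub>M borel \<rightarrow>\<^sub>M restrict_space borel S"
  proof (rule measurable_restrict_space2)
    show "(\<lambda>p. merge (f (fst p)) (snd p)) \<in> space (M \<Otimes>\<^sub>M borel) \<rightarrow> S"
      using f_R by (auto simp: S_def merge space_pair_measure)
    have [measurable]: "(\<lambda>p. f (fst p) n) \<in> borel_measurable (M \<Otimes>\<^sub>M (borel :: (nat \<Rightarrow> real) measure))" for n
      by (rule measurable_compose[OF measurable_fst measurable_compose[OF f_borel measurable_coordinate]])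
    have [measurable]: "(\<lambda>p. snd p n) \<in> borel_measurable (M \<Otimes>\<^sub>M (borel :: (nat \<Rightarrow> real) measure))" for n
      by (rule measurable_compose[OF measurable_snd measurable_coordinate])
    show "(\<lambda>p. merge (f (fst p)) (snd p)) \<in> borel_measurable (M \<Otimes>\<^sub>M borel)"
      unfolding merge_def by (rule measurable_coordinatewise_then_product) measurable
  qed
  moreover have "(\<lambda>z. (g (evens z), odds z)) \<in> restrict_space borel S \<rightarrow>\<^sub>M M \<Otimes>\<^sub>M borel"
  proof (rule measurable_Pair)
    have "evens \<in> restrict_space borel S \<rightarrow>\<^sub>M restrict_space borel R"
      by (intro measurable_restrict_space2 measurable_restrict_space1)
        (auto simp: space_restrict_space S_def)
    then show "(\<lambda>z. g (evens z)) \<in> restrict_space borel S \<rightarrow>\<^sub>M M"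
      using fg(2) by (rule measurable_compose)
    show "odds \<in> restrict_space borel S \<rightarrow>\<^sub>M borel"
      by (rule measurable_restrict_space1) simp
  qed
  ultimately have
    "measurable_isomorphic (M \<Otimes>\<^sub>M (borel :: (nat \<Rightarrow> real) measure)) (restrict_space borel S)"
    by (rule measurable_isomorphicI)
      (auto simp: space_restrict_space space_pair_measure merge S_def fg(3,4))
  moreover have "standard_borel (restrict_space borel S)"
    using standard_borel_borel S by (rule standard_borel_restrict_space)
  ultimately show ?thesis
    by (rule standard_borel_isomorphic)
qed

text \<open>Bijective case of the Lusin--Souslin theorem: disjoint sets \<open>A\<close> and \<open>space N - A\<close> of \<open>N\<close> have
  disjoint analytic images in a Borel code space for \<open>M\<close>, and a set separating them shows that
  \<open>A\<close> is in \<open>M\<close>.\<close>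

theorem standard_borel_sets_eq:
  assumes "standard_borel M" "standard_borel N" "space M = space N" "sets M \<subseteq> sets N"
  shows "sets M = sets N"
proof
  obtain R :: "(nat \<Rightarrow> real) set"
    where R: "R \<in> sets borel" "measurable_isomorphic N (restrict_space borel R)"
    by (rule standard_borelE[OF assms(2)])
  obtain f g where fg: "f \<in> N \<rightarrow>\<^sub>M restrict_space borel R" "g \<in> restrict_space borel R \<rightarrow>\<^sub>M N"
    "\<forall>x\<in>space N. g (f x) = x"
    by (rule measurable_isomorphicE[OF R(2)]) (rule that)
  obtain Q :: "(nat \<Rightarrow> real) set" where Q: "measurable_isomorphic M (restrict_space borel Q)"
    by (rule standard_borelE[OF assms(1)])
  obtain h k where hk: "h \<in> M \<rightarrow>\<^sub>M restrict_space borel Q" "\<forall>x\<in>space M. k (h x) = x"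
    by (rule measurable_isomorphicE[OF Q]) (rule that)
  have h_borel: "h \<in> borel_measurable M"
    using hk(1) by (simp add: measurable_restrict_space2_iff)
  \<comment> \<open>The inclusion of the algebras enters here: the code of \<open>M\<close> is also
    measurable for \<open>N\<close>, so sets of \<open>N\<close> have analytic images under
    it.\<close>
  have "h \<in> borel_measurable N"
    using h_borel assms(3,4) by (auto simp: measurable_def)
  then have hg: "(\<lambda>y. h (g y)) \<in> borel_measurable (restrict_space borel R)"
    using measurable_compose[OF fg(2)] by blast
  have analytic: "analytic_set (h ` A)" if A: "A \<in> sets N" for A
  proof -
    have "A \<subseteq> space N"
      using A by (rule sets.sets_into_space)
    define A' where "A' = g -` A \<inter> R"
    have "A' \<in> sets (restrict_space borel R)"
      using measurable_sets[OF fg(2) A] by (simp add: A'_def space_restrict_space)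
    then have "A' \<in> sets borel" "A' \<subseteq> R"
      using R(1) by (simp_all add: sets_restrict_space_iff)
    moreover have "(\<lambda>y. h (g y)) \<in> borel_measurable (restrict_space borel A')"
    proof -
      have "restrict_space (restrict_space borel R) A' = restrict_space borel (R \<inter> A')"
        using R(1) \<open>A' \<in> sets borel\<close> by (intro restrict_restrict_space) simp_all
      moreover have "R \<inter> A' = A'"
        using \<open>A' \<subseteq> R\<close> by blast
      ultimately show ?thesis
        using measurable_restrict_space1[OF hg, of A'] by simp
    qed
    ultimately have "analytic_set ((\<lambda>y. h (g y)) ` A')"
      by (intro analytic_set_borel_image)
    moreover have "(\<lambda>y. h (g y)) ` A' = h ` A"
    proof (intro equalityI subsetI)
      fix z
      assume "z \<in> h ` A"
      then obtain x where x: "x \<in> A" "z = h x"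
        by blast
      then have "x \<in> space N"
        using \<open>A \<subseteq> space N\<close> by blast
      then have "f x \<in> A'" "z = h (g (f x))"
        using x measurable_space[OF fg(1)] fg(3) by (auto simp: A'_def space_restrict_space)
      then show "z \<in> (\<lambda>y. h (g y)) ` A'"
        by blast
    qed (auto simp: A'_def)
    ultimately show ?thesis
      by simp
  qed
  show "sets N \<subseteq> sets M"
  proof
    fix A
    assume A: "A \<in> sets N"
    then have A_sub: "A \<subseteq> space M"
      using sets.sets_into_space assms(3) by blast
    have "inj_on h (space M)"
      using hk(2) by (metis inj_on_inverseI)
    then have "h ` A \<inter> h ` (space N - A) = {}"
      using A_sub assms(3) by (simp add: inj_on_image_Int[symmetric])
    then have "borel_separated (h ` A) (h ` (space N - A))"
      using A by (intro Lusin_separation analytic) auto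
    then obtain C where C: "C \<in> sets borel" "h ` A \<subseteq> C" "h ` (space N - A) \<inter> C = {}"
      unfolding borel_separated_def by blast
    \<comment> \<open>The separator contains the image of \<open>A\<close> and misses that of its
      complement, so its preimage under the injective code is exactly \<open>A\<close>.\<close>
    have "h -` C \<inter> space M = A"
      using A_sub C(2,3) assms(3) by blast
    then show "A \<in> sets M"
      using measurable_sets[OF h_borel C(1)] by simp
  qed
qed (rule assms(4))

section \<open>Borel fields of complete metric spaces\<close>

lemma space_fibre_product:
  "space (fibre_product p Y q V) = {(y, v). y \<in> space Y \<and> v \<in> space V \<and> p y = q v}"
  by (auto simp: fibre_product_def space_restrict_space space_pair_measure)

lemma measurable_fibre_product_fst: "fst \<in> fibre_product p Y q V \<rightarrow>\<^sub>M Y"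
  unfolding fibre_product_def by (intro measurable_restrict_space1 measurable_fst)

lemma measurable_fibre_product_snd: "snd \<in> fibre_product p Y q V \<rightarrow>\<^sub>M V"
  unfolding fibre_product_def by (intro measurable_restrict_space1 measurable_snd)

lemma measurable_fibre_product_Pair:
  assumes "f \<in> L \<rightarrow>\<^sub>M Y" "g \<in> L \<rightarrow>\<^sub>M V" "\<And>x. x \<in> space L \<Longrightarrow> p (f x) = q (g x)"
  shows "(\<lambda>x. (f x, g x)) \<in> L \<rightarrow>\<^sub>M fibre_product p Y q V"
  unfolding fibre_product_def
  by (intro measurable_restrict_space2 measurable_Pair assms(1,2)) (auto simp: assms(3))

section \<open>The algebra of a field of metric spaces generated by distances to a dense
  sequence\<close>

definition metric_field_code ::
    "('x \<Rightarrow> 'u metric) \<Rightarrow> ('x \<Rightarrow> nat \<Rightarrow> 'u) \<Rightarrow> 'x \<times> 'u \<Rightarrow> 'x \<times> (nat \<Rightarrow> real)" where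
  "metric_field_code m q = (\<lambda>v. (fst v, dist_seq (m (fst v)) (q (fst v)) (snd v)))"

text \<open>An initial structure: minimality and the criterion for maps into it come from the
  pullback, so standardness and joint measurability of the metric are what remain to be
  proved.\<close>

definition metric_field_algebra ::
    "'x measure \<Rightarrow> ('x \<Rightarrow> 'u metric) \<Rightarrow> ('x \<Rightarrow> nat \<Rightarrow> 'u) \<Rightarrow> ('x \<times> 'u) measure" where
  "metric_field_algebra X m q =
    vimage_algebra (SIGMA x:space X. mspace (m x)) (metric_field_code m q) (X \<Otimes>\<^sub>M borel)"

lemma space_metric_field_algebra:
  "space (metric_field_algebra X m q) = (SIGMA x:space X. mspace (m x))"
  by (simp add: metric_field_algebra_def)

lemma measurable_metric_field_code:
  "metric_field_code m q \<in> metric_field_algebra X m q \<rightarrow>\<^sub>M X \<Otimes>\<^sub>M borel"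
  unfolding metric_field_algebra_def
  by (rule measurable_vimage_algebra1) (auto simp: metric_field_code_def space_pair_measure)

lemma measurable_metric_field_fst: "fst \<in> metric_field_algebra X m q \<rightarrow>\<^sub>M X"
  using measurable_compose[OF measurable_metric_field_code measurable_fst, of m q X]
  by (simp add: metric_field_code_def)

lemma measurable_metric_field_dist:
  "(\<lambda>v. mdist (m (fst v)) (snd v) (q (fst v) n)) \<in> borel_measurable (metric_field_algebra X m q)"
proof -
  have "(\<lambda>v. snd (metric_field_code m q v) n) \<in> borel_measurable (metric_field_algebra X m q)"
    by (rule measurable_compose[OF measurable_compose[OF measurable_metric_field_code measurable_snd]
        measurable_coordinate])
  then show ?thesis
    by (simp add: metric_field_code_def dist_seq_def)
qed

lemma measurable_metric_field_code_comp:
  assumes "(\<lambda>z. fst (g z)) \<in> N \<rightarrow>\<^sub>M X"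
    and "\<And>n. (\<lambda>z. mdist (m (fst (g z))) (snd (g z)) (q (fst (g z)) n)) \<in> borel_measurable N"
  shows "(\<lambda>z. metric_field_code m q (g z)) \<in> N \<rightarrow>\<^sub>M X \<Otimes>\<^sub>M borel"
  unfolding metric_field_code_def dist_seq_def
  by (intro measurable_Pair assms measurable_coordinatewise_then_product)

text \<open>Reduces measurability of a map into a field to that of its base map and of countably
  many real functions.\<close>

lemma measurable_into_metric_field:
  assumes "g \<in> space N \<rightarrow> (SIGMA x:space X. mspace (m x))"
    and "(\<lambda>z. fst (g z)) \<in> N \<rightarrow>\<^sub>M X"
    and "\<And>n. (\<lambda>z. mdist (m (fst (g z))) (snd (g z)) (q (fst (g z)) n)) \<in> borel_measurable N"
  shows "g \<in> N \<rightarrow>\<^sub>M metric_field_algebra X m q"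
  unfolding metric_field_algebra_def
  using assms(1) measurable_metric_field_code_comp[OF assms(2,3)] by (rule measurable_vimage_algebra2)

lemma metric_field_algebra_least:
  assumes "space N = (SIGMA x:space X. mspace (m x))" "fst \<in> N \<rightarrow>\<^sub>M X"
    and "\<And>n. (\<lambda>v. mdist (m (fst v)) (snd v) (q (fst v) n)) \<in> borel_measurable N"
  shows "sets (metric_field_algebra X m q) \<subseteq> sets N"
  unfolding metric_field_algebra_def
  using assms(1) measurable_metric_field_code_comp[where g = "\<lambda>v. v", OF assms(2,3)]
  by (rule sets_image_in_sets)

text \<open>By density the distance of two points is the infimum over \<open>n\<close> of the sum of
  their distances to \<open>q x n\<close>, an infimum of countably many measurable
  functions.\<close>

lemma measurable_metric_field_fibre_dist:
  assumes dense: "\<And>x. x \<in> space X \<Longrightarrow> dense_seq (m x) (q x)"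
  shows "fibre_dist (\<lambda>x. mdist (m x))
    \<in> borel_measurable (fibre_product fst (metric_field_algebra X m q) fst (metric_field_algebra X m q))"
    (is "_ \<in> borel_measurable ?P")
proof -
  let ?D = "\<lambda>n v. mdist (m (fst v)) (snd v) (q (fst v) n)"
  have [measurable]: "(\<lambda>p. ?D n (fst p)) \<in> borel_measurable ?P"
      "(\<lambda>p. ?D n (snd p)) \<in> borel_measurable ?P" for n
    by (rule measurable_compose[OF measurable_fibre_product_fst measurable_metric_field_dist],
        rule measurable_compose[OF measurable_fibre_product_snd measurable_metric_field_dist])
  have "{p \<in> space ?P. fibre_dist (\<lambda>x. mdist (m x)) p < a} \<in> sets ?P" for a
  proof -
    have "fibre_dist (\<lambda>x. mdist (m x)) p < a \<longleftrightarrow> (\<exists>n. ?D n (fst p) + ?D n (snd p) < a)"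
      if p_space: "p \<in> space ?P" for p
    proof -
      obtain x u w where p: "p = ((x, u), (x, w))" "x \<in> space X" "u \<in> mspace (m x)" "w \<in> mspace (m x)"
        using p_space by (auto simp: space_fibre_product space_metric_field_algebra)
      have eq: "fibre_dist (\<lambda>x. mdist (m x)) p = mdist (m x) u w"
        "?D n (fst p) = mdist (m x) u (q x n)" "?D n (snd p) = mdist (m x) w (q x n)" for n
        by (simp_all add: p(1) fibre_dist_def)
      note q = dense_seqD(1)[OF dense[OF p(2)]]
      show ?thesis
        unfolding eq
      proof
        assume less: "mdist (m x) u w < a"
        \<comment> \<open>Going through \<open>q x n\<close> costs twice the distance from
          \<open>w\<close> to it, hence half of the slack.\<close>
        then obtain n where n: "mdist (m x) w (q x n) < (a - mdist (m x) u w) / 2"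
          using dense_seqD(2)[OF dense[OF p(2)] p(4), of "(a - mdist (m x) u w) / 2"] by auto
        then have "mdist (m x) u (q x n) + mdist (m x) w (q x n) < a"
          using mdist_triangle[OF p(3,4) q, of n] by simp
        then show "\<exists>n. mdist (m x) u (q x n) + mdist (m x) w (q x n) < a" ..
      next
        assume "\<exists>n. mdist (m x) u (q x n) + mdist (m x) w (q x n) < a"
        then obtain n where "mdist (m x) u (q x n) + mdist (m x) w (q x n) < a" ..
        then show "mdist (m x) u w < a"
          using mdist_triangle[OF p(3) q p(4), of n] mdist_commute[of "m x" w "q x n"] by simp
      qed
    qed
    then have "{p \<in> space ?P. fibre_dist (\<lambda>x. mdist (m x)) p < a} =
        {p \<in> space ?P. \<exists>n. ?D n (fst p) + ?D n (snd p) < a}"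
      by blast
    also have "\<dots> \<in> sets ?P"
      by measurable
    finally show ?thesis .
  qed
  then show ?thesis
    by (simp add: borel_measurable_iff_less)
qed

text \<open>Applied fibre by fibre, \<open>range_dist_seq\<close> identifies the image of the code
  with a measurable subset of the product of \<open>X\<close> with the sequence space. The last
  hypothesis makes that subset measurable.\<close>

lemma standard_borel_metric_field_algebra:
  assumes X: "standard_borel X"
    and complete: "\<And>x. x \<in> space X \<Longrightarrow> mcomplete_of (m x)"
    and dense: "\<And>x. x \<in> space X \<Longrightarrow> dense_seq (m x) (q x)"
    and meas: "\<And>i j. (\<lambda>x. mdist (m x) (q x i) (q x j)) \<in> borel_measurable X"
  shows "standard_borel (metric_field_algebra X m q)"
proof -
  let ?\<Omega> = "SIGMA x:space X. mspace (m x)" and ?F = "metric_field_code m q"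
  let ?P = "X \<Otimes>\<^sub>M (borel :: (nat \<Rightarrow> real) measure)"
  define S where "S = {p \<in> space ?P. dist_profile (\<lambda>i j. mdist (m (fst p)) (q (fst p) i) (q (fst p) j)) (snd p)}"
  have S: "S \<in> sets ?P"
    unfolding S_def using dist_profile_measurable[of "\<lambda>x i j. mdist (m x) (q x i) (q x j)" X] meas
    by simp
  have range: "(x, y) \<in> S \<longleftrightarrow> x \<in> space X \<and> y \<in> dist_seq (m x) (q x) ` mspace (m x)" for x y
    using range_dist_seq[OF complete dense, of x] by (auto simp: S_def space_pair_measure)
  have F_S: "?F v \<in> S" if "v \<in> ?\<Omega>" for v
    using that unfolding metric_field_code_def range by auto
  define g where "g = (\<lambda>p. (fst p, the_inv_into (mspace (m (fst p))) (dist_seq (m (fst p)) (q (fst p))) (snd p)))"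
  have gF: "g (?F v) = v" if "v \<in> ?\<Omega>" for v
    using that the_inv_into_f_f[OF inj_on_dist_seq[OF dense]]
    by (auto simp: g_def metric_field_code_def)
  have ex: "\<exists>v\<in>?\<Omega>. p = ?F v" if p: "p \<in> S" for p
  proof -
    have "fst p \<in> space X" "snd p \<in> dist_seq (m (fst p)) (q (fst p)) ` mspace (m (fst p))"
      using p range[of "fst p" "snd p"] by simp_all
    then obtain u where "u \<in> mspace (m (fst p))" "snd p = dist_seq (m (fst p)) (q (fst p)) u"
      by blast
    then show ?thesis
      using \<open>fst p \<in> space X\<close>
      by (intro bexI[of _ "(fst p, u)"]) (auto simp: metric_field_code_def prod_eq_iff)
  qed
  have Fg: "g p \<in> ?\<Omega>" "?F (g p) = p" if p: "p \<in> S" for p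
  proof -
    obtain v where v: "v \<in> ?\<Omega>" "p = ?F v"
      using ex[OF p] ..
    then show "g p \<in> ?\<Omega>" "?F (g p) = p"
      using gF[OF v(1)] by (simp_all only:)
  qed
  have "?F \<in> metric_field_algebra X m q \<rightarrow>\<^sub>M restrict_space ?P S"
    using F_S measurable_metric_field_code
    by (intro measurable_restrict_space2) (auto simp: space_metric_field_algebra)
  moreover have "g \<in> restrict_space ?P S \<rightarrow>\<^sub>M metric_field_algebra X m q"
    unfolding metric_field_algebra_def
  proof (rule measurable_vimage_algebra2)
    show "g \<in> space (restrict_space ?P S) \<rightarrow> ?\<Omega>"
      using Fg(1) by (auto simp: space_restrict_space)
    \<comment> \<open>Measurability into a pullback is tested after composing with the code, and
      code after decoding is the identity on \<open>S\<close>.\<close>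
    have "(\<lambda>p. p) \<in> restrict_space ?P S \<rightarrow>\<^sub>M ?P"
      by (intro measurable_restrict_space1 measurable_ident_sets refl)
    then show "(\<lambda>p. ?F (g p)) \<in> restrict_space ?P S \<rightarrow>\<^sub>M ?P"
      by (rule measurable_cong[THEN iffD1, rotated]) (simp add: Fg(2) space_restrict_space)
  qed
  ultimately have "measurable_isomorphic (metric_field_algebra X m q) (restrict_space ?P S)"
    by (rule measurable_isomorphicI) (simp_all only: space_metric_field_algebra space_restrict_space gF Fg Int_iff)
  moreover have "standard_borel (restrict_space ?P S)"
    by (intro standard_borel_restrict_space standard_borel_pair_borel X S)
  ultimately show ?thesis
    by (rule standard_borel_isomorphic)
qed

text \<open>The base map \<open>s\<close> is arbitrary: the identity gives distances between
  sections, and \<open>fst\<close> gives the distance from a point to the value of a section below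
  it.\<close>

lemma measurable_dist_sections:
  assumes "fibre_dist d \<in> borel_measurable (fibre_product fst N fst N)"
    and "(\<lambda>z. (s z, a z)) \<in> L \<rightarrow>\<^sub>M N" "(\<lambda>z. (s z, b z)) \<in> L \<rightarrow>\<^sub>M N"
  shows "(\<lambda>z. d (s z) (a z) (b z)) \<in> borel_measurable L"
proof -
  have "(\<lambda>z. ((s z, a z), (s z, b z))) \<in> L \<rightarrow>\<^sub>M fibre_product fst N fst N"
    using assms(2,3) by (rule measurable_fibre_product_Pair) simp
  from measurable_compose[OF this assms(1)] show ?thesis
    by (simp add: fibre_dist_def)
qed

text \<open>Measurability of the metric and of the sections makes \<open>N\<close> contain the
  distance algebra; two nested standard Borel structures agree. This serves for both the completion
  and the target field \<open>W\<close>.\<close>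

lemma metric_field_algebra_unique:
  assumes X: "standard_borel X" and N: "standard_borel N"
    and space_N: "space N = (SIGMA x:space X. mspace (m x))"
    and fst_N: "fst \<in> N \<rightarrow>\<^sub>M X"
    and dist_N: "fibre_dist (\<lambda>x. mdist (m x)) \<in> borel_measurable (fibre_product fst N fst N)"
    and complete: "\<And>x. x \<in> space X \<Longrightarrow> mcomplete_of (m x)"
    and dense: "\<And>x. x \<in> space X \<Longrightarrow> dense_seq (m x) (q x)"
    and sections: "\<And>n. (\<lambda>x. (x, q x n)) \<in> X \<rightarrow>\<^sub>M N"
  shows "sets N = sets (metric_field_algebra X m q)"
proof (rule standard_borel_sets_eq[symmetric])
  show "standard_borel (metric_field_algebra X m q)"
    using X complete dense measurable_dist_sections[OF dist_N sections sections]
    by (rule standard_borel_metric_field_algebra)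
  show "sets (metric_field_algebra X m q) \<subseteq> sets N"
  proof (rule metric_field_algebra_least[OF space_N fst_N])
    show "(\<lambda>v. mdist (m (fst v)) (snd v) (q (fst v) n)) \<in> borel_measurable N" for n
      by (rule measurable_dist_sections[OF dist_N _ measurable_compose[OF fst_N sections]])
        (simp add: measurable_ident_sets)
  qed
qed (simp_all add: N space_N space_metric_field_algebra)

text \<open>A fibrewise continuous function is the pointwise limit of its values at the first member of
  the dense sequence within distance \<open>1 / (k + 1)\<close> of the argument.\<close>

lemma measurable_fibrewise_continuous:
  fixes F :: "'y \<Rightarrow> 'u \<Rightarrow> real" and X :: "'x measure"
  assumes p: "p \<in> Y \<rightarrow>\<^sub>M X"
    and dense: "\<And>x. x \<in> space X \<Longrightarrow> dense_seq (m x) (q x)"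
    and cont: "\<And>y. y \<in> space Y \<Longrightarrow> continuous_map (mtopology_of (m (p y))) euclidean (F y)"
    and meas: "\<And>n. (\<lambda>y. F y (q (p y) n)) \<in> borel_measurable Y"
  shows "(\<lambda>z. F (fst z) (snd (snd z)))
    \<in> borel_measurable (fibre_product p Y fst (metric_field_algebra X m q))"
    (is "_ \<in> borel_measurable ?P")
proof (rule borel_measurable_LIMSEQ_real)
  let ?near = "\<lambda>k z n. mdist (m (fst (snd z))) (snd (snd z)) (q (fst (snd z)) n) < inverse (Suc k)"
  \<comment> \<open>Taking the least admissible index makes the choice measurable in
    \<open>z\<close>. It takes countably many values, so substituting it for a fixed
    \<open>n\<close> preserves measurability.\<close>
  define idx where "idx = (\<lambda>k (z :: 'y \<times> 'x \<times> 'u). LEAST n. ?near k z n)"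
  have [measurable]: "(\<lambda>z. mdist (m (fst (snd z))) (snd (snd z)) (q (fst (snd z)) n))
      \<in> borel_measurable ?P" for n
    by (rule measurable_compose[OF measurable_fibre_product_snd measurable_metric_field_dist])
  have "idx k \<in> ?P \<rightarrow>\<^sub>M count_space UNIV" for k
    unfolding idx_def by measurable
  moreover have "(\<lambda>z. F (fst z) (q (p (fst z)) n)) \<in> borel_measurable ?P" for n
    by (rule measurable_compose[OF measurable_fibre_product_fst meas])
  ultimately show "(\<lambda>z. F (fst z) (q (p (fst z)) (idx k z))) \<in> borel_measurable ?P" for k
    by (rule measurable_compose_countable[rotated])
  fix z
  assume "z \<in> space ?P"
  then obtain y u where z: "z = (y, (p y, u))" "y \<in> space Y" "u \<in> mspace (m (p y))" "p y \<in> space X"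
    by (auto simp: space_fibre_product space_metric_field_algebra)
  note q = dense_seqD[OF dense[OF z(4)]]
  have near: "mdist (m (p y)) (q (p y) (idx k z)) u < inverse (Suc k)" for k
  proof -
    have "\<exists>n. ?near k z n"
      using q(2)[OF z(3), of "inverse (Suc k)"] by (simp add: z(1))
    then have "?near k z (idx k z)"
      unfolding idx_def by (rule LeastI_ex)
    then show ?thesis
      by (simp add: z(1) mdist_commute)
  qed
  have "limitin (mtopology_of (m (p y))) (\<lambda>k. q (p y) (idx k z)) u sequentially"
    unfolding limitin_mtopology_of
  proof (intro conjI allI impI z(3))
    fix \<epsilon> :: real
    assume "\<epsilon> > 0"
    then obtain N where N: "inverse (Suc N) < \<epsilon>"
      using reals_Archimedean by auto
    have "q (p y) (idx k z) \<in> mspace (m (p y)) \<and> mdist (m (p y)) (q (p y) (idx k z)) u < \<epsilon>"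
      if "k \<ge> N" for k
    proof -
      have "inverse (Suc k) \<le> inverse (Suc N)"
        using that by (auto intro: le_imp_inverse_le)
      then show ?thesis
        using near[of k] N q(1) by (intro conjI) (blast, linarith)
    qed
    then show "\<exists>N. \<forall>k\<ge>N. q (p y) (idx k z) \<in> mspace (m (p y)) \<and>
        mdist (m (p y)) (q (p y) (idx k z)) u < \<epsilon>"
      by blast
  qed
  from continuous_map_limit[OF cont[OF z(2)] this]
  have "(\<lambda>k. F y (q (p y) (idx k z))) \<longlonglongrightarrow> F y u"
    by (simp add: comp_def)
  then show "(\<lambda>k. F (fst z) (q (p (fst z)) (idx k z))) \<longlonglongrightarrow> F (fst z) (snd (snd z))"
    by (simp add: z(1))
qed

section \<open>Structures on a field of separation-completions\<close>

lemma separation_completionD: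
  assumes "separation_completion S d S' \<gamma>"
  shows "mcomplete_of S'" "v \<in> S \<Longrightarrow> \<gamma> v \<in> mspace S'"
    "v \<in> S \<Longrightarrow> w \<in> S \<Longrightarrow> mdist S' (\<gamma> v) (\<gamma> w) = d v w"
    "u \<in> mspace S' \<Longrightarrow> 0 < \<epsilon> \<Longrightarrow> \<exists>v\<in>S. mdist S' u (\<gamma> v) < \<epsilon>"
proof -
  show "\<exists>v\<in>S. mdist S' u (\<gamma> v) < \<epsilon>" if "u \<in> mspace S'" "0 < \<epsilon>"
  proof -
    have "u \<in> mtopology_of S' closure_of (\<gamma> ` S)"
      using assms that(1) by (simp add: separation_completion_def)
    then show ?thesis
      using that(2) by (auto simp: closure_of_mtopology_of)
  qed
qed (use assms in \<open>auto simp: separation_completion_def\<close>)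

lemma dense_seq_completion:
  assumes sc: "\<And>x. x \<in> space X \<Longrightarrow> separation_completion (V x) (d x) (V' x) (\<gamma> x)"
    and \<phi>: "pseudometric_dense_sections X V d M \<phi>"
    and x: "x \<in> space X"
  shows "dense_seq (V' x) (\<lambda>n. \<gamma> x (\<phi> n x))"
  unfolding dense_seq_def
proof (intro conjI ballI allI impI)
  note sc = separation_completionD[OF sc[OF x]]
  have \<phi>_V: "\<phi> n x \<in> V x" for n
    using \<phi> x by (simp add: pseudometric_dense_sections_def borel_section_def)
  then show "range (\<lambda>n. \<gamma> x (\<phi> n x)) \<subseteq> mspace (V' x)"
    using sc(2) by auto
  fix u and \<epsilon> :: real
  assume u: "u \<in> mspace (V' x)" and \<epsilon>: "\<epsilon> > 0"
  then obtain v where v: "v \<in> V x" "mdist (V' x) u (\<gamma> x v) < \<epsilon> / 2"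
    using sc(4)[OF u, of "\<epsilon> / 2"] by auto
  have "\<exists>n. d x v (\<phi> n x) < \<epsilon> / 2"
    using \<phi> x v(1) half_gt_zero[OF \<epsilon>] unfolding pseudometric_dense_sections_def by blast
  then obtain n where "d x v (\<phi> n x) < \<epsilon> / 2" ..
  then have "mdist (V' x) (\<gamma> x v) (\<gamma> x (\<phi> n x)) < \<epsilon> / 2"
    using sc(3)[OF v(1) \<phi>_V] by simp
  then have "mdist (V' x) u (\<gamma> x (\<phi> n x)) < \<epsilon>"
    using v(2) mdist_triangle[OF u sc(2)[OF v(1)] sc(2)[OF \<phi>_V], of n] by simp
  then show "\<exists>n. mdist (V' x) u (\<gamma> x (\<phi> n x)) < \<epsilon>" ..
qed

text \<open>Composing the sections of \<open>V\<close> with \<gamma> gives measurable dense sections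
  for \<open>N\<close>. The left side does not mention \<phi> and the right side does not mention
  \<open>N\<close>, so this yields both uniqueness of the structure and independence of the dense
  sequence.\<close>

lemma completion_structure_unique:
  assumes X: "standard_borel X"
    and N: "completion_structure X M V' \<gamma> N"
    and sc: "\<And>x. x \<in> space X \<Longrightarrow> separation_completion (V x) (d x) (V' x) (\<gamma> x)"
    and \<phi>: "pseudometric_dense_sections X V d M \<phi>"
  shows "sets N = sets (metric_field_algebra X V' (\<lambda>x n. \<gamma> x (\<phi> n x)))"
proof (rule metric_field_algebra_unique[OF X])
  show "standard_borel N" "space N = (SIGMA x:space X. mspace (V' x))" "fst \<in> N \<rightarrow>\<^sub>M X"
    "fibre_dist (\<lambda>x. mdist (V' x)) \<in> borel_measurable (fibre_product fst N fst N)"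
    using N by (simp_all add: completion_structure_def)
  show "mcomplete_of (V' x)" "dense_seq (V' x) (\<lambda>n. \<gamma> x (\<phi> n x))" if x: "x \<in> space X" for x
    using separation_completionD(1)[OF sc[OF x]] dense_seq_completion[OF sc \<phi> x] .
  show "(\<lambda>x. (x, \<gamma> x (\<phi> n x))) \<in> X \<rightarrow>\<^sub>M N" for n
  proof -
    have "(\<lambda>x. (x, \<phi> n x)) \<in> X \<rightarrow>\<^sub>M M" "total_map \<gamma> \<in> M \<rightarrow>\<^sub>M N"
      using \<phi> N by (simp_all add: pseudometric_dense_sections_def borel_section_def completion_structure_def)
    from measurable_compose[OF this] show ?thesis
      by (simp add: total_map_def)
  qed
qed

text \<open>Isometry of \<gamma> turns each required distance in the completion into a distance in
  \<open>V\<close>, where joint measurability is given.\<close>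

lemma completion_structure_metric_field_algebra:
  assumes V: "borel_field_pseudometric X V d M"
    and sc: "\<And>x. x \<in> space X \<Longrightarrow> separation_completion (V x) (d x) (V' x) (\<gamma> x)"
    and \<phi>: "pseudometric_dense_sections X V d M \<phi>"
  shows "completion_structure X M V' \<gamma> (metric_field_algebra X V' (\<lambda>x n. \<gamma> x (\<phi> n x)))"
    (is "completion_structure X M V' \<gamma> ?M'")
  unfolding completion_structure_def
proof (intro conjI)
  have X: "standard_borel X" and space_M: "space M = (SIGMA x:space X. V x)"
    and fst_M: "fst \<in> M \<rightarrow>\<^sub>M X"
    and dist_M: "fibre_dist d \<in> borel_measurable (fibre_product fst M fst M)"
    using V by (simp_all add: borel_field_pseudometric_def)
  have sections: "(\<lambda>x. (x, \<phi> n x)) \<in> X \<rightarrow>\<^sub>M M" for n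
    using \<phi> by (simp add: pseudometric_dense_sections_def borel_section_def)
  have \<phi>_V: "\<phi> n x \<in> V x" if "x \<in> space X" for n x
    using \<phi> that by (simp add: pseudometric_dense_sections_def borel_section_def)
  have dense: "dense_seq (V' x) (\<lambda>n. \<gamma> x (\<phi> n x))" if x: "x \<in> space X" for x
    by (rule dense_seq_completion[OF sc \<phi> x])
  show "standard_borel ?M'"
  proof (rule standard_borel_metric_field_algebra[OF X _ dense])
    show "mcomplete_of (V' x)" if "x \<in> space X" for x
      using separation_completionD(1)[OF sc[OF that]] .
    have "(\<lambda>x. d x (\<phi> i x) (\<phi> j x)) \<in> borel_measurable X" for i j
      by (rule measurable_dist_sections[OF dist_M sections sections])
    then show "(\<lambda>x. mdist (V' x) (\<gamma> x (\<phi> i x)) (\<gamma> x (\<phi> j x))) \<in> borel_measurable X" for i j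
      by (rule measurable_cong[THEN iffD1, rotated])
        (simp add: separation_completionD(3)[OF sc] \<phi>_V)
  qed
  show "total_map \<gamma> \<in> M \<rightarrow>\<^sub>M ?M'"
  proof (rule measurable_into_metric_field)
    show "total_map \<gamma> \<in> space M \<rightarrow> (SIGMA x:space X. mspace (V' x))"
      using separation_completionD(2)[OF sc] by (auto simp: space_M total_map_def)
    show "(\<lambda>v. fst (total_map \<gamma> v)) \<in> M \<rightarrow>\<^sub>M X"
      using fst_M by (simp add: total_map_def case_prod_beta)
    fix n
    have "(\<lambda>v. d (fst v) (snd v) (\<phi> n (fst v))) \<in> borel_measurable M"
      by (rule measurable_dist_sections[OF dist_M _ measurable_compose[OF fst_M sections]])
        (simp add: measurable_ident_sets)
    then show "(\<lambda>v. mdist (V' (fst (total_map \<gamma> v))) (snd (total_map \<gamma> v))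
        (\<gamma> (fst (total_map \<gamma> v)) (\<phi> n (fst (total_map \<gamma> v))))) \<in> borel_measurable M"
    proof (rule measurable_cong[THEN iffD1, rotated])
      fix v
      assume "v \<in> space M"
      then show "d (fst v) (snd v) (\<phi> n (fst v)) = mdist (V' (fst (total_map \<gamma> v)))
          (snd (total_map \<gamma> v)) (\<gamma> (fst (total_map \<gamma> v)) (\<phi> n (fst (total_map \<gamma> v))))"
        using separation_completionD(3)[OF sc, of "fst v" "snd v" "\<phi> n (fst v)"] \<phi>_V
        by (auto simp: total_map_def space_M)
    qed
  qed
  show "fibre_dist (\<lambda>x. mdist (V' x)) \<in> borel_measurable (fibre_product fst ?M' fst ?M')"
    using dense by (rule measurable_metric_field_fibre_dist)
qed (simp_all add: space_metric_field_algebra measurable_metric_field_fst)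

text \<open>One direction is composition with \<gamma>. For the other, measurability into
  \<open>W\<close> is tested on distances to dense sections \<psi> of \<open>W\<close>; these are
  fibrewise continuous in \<open>v\<close>, so it suffices to know them along the points
  \<open>\<gamma> x (\<phi> k x)\<close>, where the hypothesis applies.\<close>

lemma measurable_fibrewise_continuous_iff:
  assumes V: "borel_field_pseudometric X V d M"
    and sc: "\<And>x. x \<in> space X \<Longrightarrow> separation_completion (V x) (d x) (V' x) (\<gamma> x)"
    and M': "completion_structure X M V' \<gamma> M'"
    and W: "borel_field_polish X W MW"
    and p: "p \<in> Y \<rightarrow>\<^sub>M X"
    and C_space: "C \<in> space (fibre_product p Y fst M') \<rightarrow> space MW"
    and C_fst: "\<forall>(y, v) \<in> space (fibre_product p Y fst M'). fst (C (y, v)) = p y"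
    and C_cont: "\<forall>y\<in>space Y.
      continuous_map (mtopology_of (V' (p y))) (W (p y)) (\<lambda>v. snd (C (y, (p y, v))))"
  shows "C \<in> fibre_product p Y fst M' \<rightarrow>\<^sub>M MW \<longleftrightarrow>
    (\<lambda>(y, v). C (y, total_map \<gamma> v)) \<in> fibre_product p Y fst M \<rightarrow>\<^sub>M MW"
proof
  let ?P = "fibre_product p Y fst M" and ?P' = "fibre_product p Y fst M'"
  assume C: "C \<in> ?P' \<rightarrow>\<^sub>M MW"
  have \<gamma>_meas: "total_map \<gamma> \<in> M \<rightarrow>\<^sub>M M'"
    using M' by (simp add: completion_structure_def)
  have "(\<lambda>z. (fst z, total_map \<gamma> (snd z))) \<in> ?P \<rightarrow>\<^sub>M ?P'"
    by (rule measurable_fibre_product_Pair[OF measurable_fibre_product_fst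
          measurable_compose[OF measurable_fibre_product_snd \<gamma>_meas]])
      (auto simp: space_fibre_product total_map_def)
  from measurable_compose[OF this C]
  show "(\<lambda>(y, v). C (y, total_map \<gamma> v)) \<in> ?P \<rightarrow>\<^sub>M MW"
    by (simp add: case_prod_beta)
next
  let ?P = "fibre_product p Y fst M" and ?P' = "fibre_product p Y fst M'"
  assume C\<gamma>: "(\<lambda>(y, v). C (y, total_map \<gamma> v)) \<in> ?P \<rightarrow>\<^sub>M MW"
  have space_M': "space M' = (SIGMA x:space X. mspace (V' x))"
    using M' by (simp add: completion_structure_def)
  have X: "standard_borel X"
    using V by (simp add: borel_field_pseudometric_def)
  obtain \<phi> where \<phi>: "pseudometric_dense_sections X V d M \<phi>"
    using V unfolding borel_field_pseudometric_def by blast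
  have \<phi>_meas: "(\<lambda>x. (x, \<phi> n x)) \<in> X \<rightarrow>\<^sub>M M" and \<phi>_V: "x \<in> space X \<Longrightarrow> \<phi> n x \<in> V x" for n x
    using \<phi> by (simp_all add: pseudometric_dense_sections_def borel_section_def)
  have dense: "dense_seq (V' x) (\<lambda>n. \<gamma> x (\<phi> n x))" if x: "x \<in> space X" for x
    by (rule dense_seq_completion[OF sc \<phi> x])
  have sets_M': "sets M' = sets (metric_field_algebra X V' (\<lambda>x n. \<gamma> x (\<phi> n x)))"
    by (rule completion_structure_unique[OF X M' sc \<phi>])
  obtain D \<psi> where D: "fibre_dist (\<lambda>x. mdist (D x)) \<in> borel_measurable (fibre_product fst MW fst MW)"
    "\<And>x. x \<in> space X \<Longrightarrow> mtopology_of (D x) = W x \<and> mcomplete_of (D x)"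
    and \<psi>: "topological_dense_sections X W MW \<psi>"
    using W unfolding borel_field_polish_def by blast
  have D_space: "mspace (D x) = topspace (W x)" if "x \<in> space X" for x
    using D(2)[OF that] by (metis topspace_mtopology_of)
  have space_MW: "space MW = (SIGMA x:space X. mspace (D x))"
    using W D_space by (auto simp: borel_field_polish_def)
  have \<psi>_meas: "(\<lambda>x. (x, \<psi> n x)) \<in> X \<rightarrow>\<^sub>M MW" for n
    using \<psi> by (simp add: topological_dense_sections_def borel_section_def)
  have \<psi>_dense: "dense_seq (D x) (\<lambda>n. \<psi> n x)" if x: "x \<in> space X" for x
    using \<psi> x D(2)[OF x] D_space[OF x]
    by (auto simp: dense_seq_iff_closure_of topological_dense_sections_def borel_section_def)
  \<comment> \<open>The abstract structure of \<open>W\<close> is replaced by the distance algebra,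
    which depends on uniqueness and hence on Lusin separation.\<close>
  have sets_MW: "sets MW = sets (metric_field_algebra X D (\<lambda>x n. \<psi> n x))"
    using W D \<psi>_meas \<psi>_dense
    by (intro metric_field_algebra_unique[OF X _ space_MW]) (auto simp: borel_field_polish_def)
  have dist_MW: "(\<lambda>w. mdist (D (fst w)) (snd w) (\<psi> n (fst w))) \<in> borel_measurable MW" for n
    unfolding measurable_cong_sets[OF sets_MW refl] by (rule measurable_metric_field_dist)
  have sets_P': "sets ?P' = sets (fibre_product p Y fst (metric_field_algebra X V' (\<lambda>x n. \<gamma> x (\<phi> n x))))"
    unfolding fibre_product_def
    by (intro sets_restrict_space_cong sets_pair_measure_cong refl sets_M')
  have "C \<in> ?P' \<rightarrow>\<^sub>M metric_field_algebra X D (\<lambda>x n. \<psi> n x)"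
  proof (rule measurable_into_metric_field)
    show "C \<in> space ?P' \<rightarrow> (SIGMA x:space X. mspace (D x))"
      using C_space by (simp only: space_MW)
    have fst_C: "fst (C z) = p (fst z)" if "z \<in> space ?P'" for z
      using C_fst that by auto
    show "(\<lambda>z. fst (C z)) \<in> ?P' \<rightarrow>\<^sub>M X"
      using measurable_compose[OF measurable_fibre_product_fst p]
      by (rule measurable_cong[THEN iffD1, rotated]) (simp add: fst_C)
    fix n
    define F where "F = (\<lambda>y u. mdist (D (p y)) (snd (C (y, (p y, u)))) (\<psi> n (p y)))"
    have "(\<lambda>z. F (fst z) (snd (snd z))) \<in> borel_measurable ?P'"
      unfolding measurable_cong_sets[OF sets_P' refl]
    proof (rule measurable_fibrewise_continuous[OF p dense])
      fix y
      assume y: "y \<in> space Y"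
      then have py: "p y \<in> space X"
        using measurable_space[OF p] by blast
      have "continuous_map (mtopology_of (V' (p y))) (mtopology_of (D (p y))) (\<lambda>u. snd (C (y, (p y, u))))"
        using C_cont y D(2)[OF py] by simp
      then show "continuous_map (mtopology_of (V' (p y))) euclidean (F y)"
        unfolding F_def using dense_seqD(1)[OF \<psi>_dense[OF py]]
        by (intro continuous_map_mdist) simp_all
    next
      fix k
      \<comment> \<open>Pulling a section back along \<open>p\<close> turns the hypothesis on the
        fibre product into a statement about functions of \<open>y\<close> alone.\<close>
      have "(\<lambda>y. (y, (p y, \<phi> k (p y)))) \<in> Y \<rightarrow>\<^sub>M ?P"
        by (rule measurable_fibre_product_Pair[OF _ measurable_compose[OF p \<phi>_meas]])
          (simp_all add: measurable_ident_sets)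
      from measurable_compose[OF this C\<gamma>]
      have "(\<lambda>y. C (y, (p y, \<gamma> (p y) (\<phi> k (p y))))) \<in> Y \<rightarrow>\<^sub>M MW"
        by (simp add: total_map_def)
      from measurable_compose[OF this dist_MW[of n]]
      show "(\<lambda>y. F y (\<gamma> (p y) (\<phi> k (p y)))) \<in> borel_measurable Y"
      proof (rule measurable_cong[THEN iffD1, rotated])
        fix y
        assume y: "y \<in> space Y"
        then have py: "p y \<in> space X"
          using measurable_space[OF p] by blast
        have "(y, (p y, \<gamma> (p y) (\<phi> k (p y)))) \<in> space ?P'"
          using y py separation_completionD(2)[OF sc[OF py] \<phi>_V[OF py]]
          by (simp add: space_fibre_product space_M')
        then show "mdist (D (fst (C (y, (p y, \<gamma> (p y) (\<phi> k (p y)))))))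
            (snd (C (y, (p y, \<gamma> (p y) (\<phi> k (p y))))))
            (\<psi> n (fst (C (y, (p y, \<gamma> (p y) (\<phi> k (p y))))))) = F y (\<gamma> (p y) (\<phi> k (p y)))"
          using fst_C by (simp add: F_def)
      qed
    qed
    then show "(\<lambda>z. mdist (D (fst (C z))) (snd (C z)) (\<psi> n (fst (C z)))) \<in> borel_measurable ?P'"
    proof (rule measurable_cong[THEN iffD1, rotated])
      fix z
      assume z: "z \<in> space ?P'"
      then have "z = (fst z, (p (fst z), snd (snd z)))"
        by (auto simp: space_fibre_product)
      then show "F (fst z) (snd (snd z)) = mdist (D (fst (C z))) (snd (C z)) (\<psi> n (fst (C z)))"
        using fst_C[OF z] by (simp add: F_def)
    qed
  qed
  then show "C \<in> ?P' \<rightarrow>\<^sub>M MW"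
    unfolding measurable_cong_sets[OF refl sets_MW] .
qed

lemma borel_field_polish_completion_structure:
  assumes V: "borel_field_pseudometric X V d M"
    and sc: "\<And>x. x \<in> space X \<Longrightarrow> separation_completion (V x) (d x) (V' x) (\<gamma> x)"
    and M': "completion_structure X M V' \<gamma> M'"
  shows "borel_field_polish X (\<lambda>x. mtopology_of (V' x)) M'"
proof -
  obtain \<phi> where \<phi>: "pseudometric_dense_sections X V d M \<phi>"
    using V unfolding borel_field_pseudometric_def by blast
  have dense: "dense_seq (V' x) (\<lambda>n. \<gamma> x (\<phi> n x))" if x: "x \<in> space X" for x
    by (rule dense_seq_completion[OF sc \<phi> x])
  have complete: "mcomplete_of (V' x)" if "x \<in> space X" for x
    using separation_completionD(1)[OF sc[OF that]] .
  have separable: "separable_space (mtopology_of (V' x))" if "x \<in> space X" for x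
    using dense[OF that] by (rule dense_seq_separable_space)
  have polish: "polish_topology (mtopology_of (V' x))" if "x \<in> space X" for x
    using complete[OF that] separable[OF that]
    unfolding polish_topology_def completely_metrizable_space_def mcomplete_of_def mtopology_of_def
    by (auto intro!: exI[of _ "mspace (V' x)"] exI[of _ "mdist (V' x)"])
  have "(\<lambda>x. (x, \<gamma> x (\<phi> n x))) \<in> X \<rightarrow>\<^sub>M M'" for n
  proof -
    have "(\<lambda>x. (x, \<phi> n x)) \<in> X \<rightarrow>\<^sub>M M" "total_map \<gamma> \<in> M \<rightarrow>\<^sub>M M'"
      using \<phi> M' by (simp_all add: pseudometric_dense_sections_def borel_section_def completion_structure_def)
    from measurable_compose[OF this] show ?thesis
      by (simp add: total_map_def)
  qed
  then have sections: "topological_dense_sections X (\<lambda>x. mtopology_of (V' x)) M' (\<lambda>n x. \<gamma> x (\<phi> n x))"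
    using dense dense_seqD(1)[OF dense]
    by (simp add: topological_dense_sections_def borel_section_def dense_seq_iff_closure_of)
  show ?thesis
    unfolding borel_field_polish_def
    using V M' complete separable polish sections
    by (auto simp: completion_structure_def borel_field_pseudometric_def)
qed

text \<open>A single \<open>M'\<close> is fixed before all other quantifiers, so the three
  assertions concern the same structure. Uniqueness is equality of \<open>sets\<close>, since
  measures stand for measurable spaces here.\<close>

theorem proposition6p2:
  fixes X :: "'x measure"
    and V :: "'x \<Rightarrow> 'v set"
    and d :: "'x \<Rightarrow> 'v \<Rightarrow> 'v \<Rightarrow> real"
    and M :: "('x \<times> 'v) measure"
    and V' :: "'x \<Rightarrow> 'u metric"
    and \<gamma> :: "'x \<Rightarrow> 'v \<Rightarrow> 'u"
  assumes "borel_field_pseudometric X V d M"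
    and "\<And>x. x \<in> space X \<Longrightarrow> separation_completion (V x) (d x) (V' x) (\<gamma> x)"
  shows "\<exists>M' :: ('x \<times> 'u) measure.
    (completion_structure X M V' \<gamma> M' \<and>
     (\<forall>N. completion_structure X M V' \<gamma> N \<longrightarrow> sets N = sets M') \<and>
     borel_field_polish X (\<lambda>x. mtopology_of (V' x)) M') \<and>
    (\<forall>\<phi> :: nat \<Rightarrow> 'x \<Rightarrow> 'v. pseudometric_dense_sections X V d M \<phi> \<longrightarrow>
       smallest_sigma_algebra
         (\<lambda>N. fst \<in> N \<rightarrow>\<^sub>M X \<and>
              (\<forall>n. (\<lambda>v. mdist (V' (fst v)) (snd v) (\<gamma> (fst v) (\<phi> n (fst v))))
                     \<in> borel_measurable N)) M') \<and>
    (\<forall>(Y :: 'y measure) (p :: 'y \<Rightarrow> 'x) (W :: 'x \<Rightarrow> 'w topology) (MW :: ('x \<times> 'w) measure)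
        (C :: 'y \<times> ('x \<times> 'u) \<Rightarrow> 'x \<times> 'w).
       borel_field_polish X W MW \<and>
       p \<in> Y \<rightarrow>\<^sub>M X \<and>
       C \<in> space (fibre_product p Y fst M') \<rightarrow> space MW \<and>
       (\<forall>(y, v) \<in> space (fibre_product p Y fst M'). fst (C (y, v)) = p y) \<and>
       (\<forall>y\<in>space Y.
          continuous_map (mtopology_of (V' (p y))) (W (p y)) (\<lambda>v. snd (C (y, (p y, v))))) \<longrightarrow>
       (C \<in> fibre_product p Y fst M' \<rightarrow>\<^sub>M MW \<longleftrightarrow>
        (\<lambda>(y, v). C (y, total_map \<gamma> v)) \<in> fibre_product p Y fst M \<rightarrow>\<^sub>M MW))"
proof -
  have X: "standard_borel X"
    using assms(1) by (simp add: borel_field_pseudometric_def)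
  obtain \<phi>0 where \<phi>0: "pseudometric_dense_sections X V d M \<phi>0"
    using assms(1) unfolding borel_field_pseudometric_def by blast
  define M' where "M' = metric_field_algebra X V' (\<lambda>x n. \<gamma> x (\<phi>0 n x))"
  have M': "completion_structure X M V' \<gamma> M'"
    unfolding M'_def by (rule completion_structure_metric_field_algebra[OF assms \<phi>0])
  have unique: "sets N = sets M'" if "completion_structure X M V' \<gamma> N" for N
    unfolding M'_def by (rule completion_structure_unique[OF X that assms(2) \<phi>0])
  have smallest: "smallest_sigma_algebra
      (\<lambda>N. fst \<in> N \<rightarrow>\<^sub>M X \<and>
        (\<forall>n. (\<lambda>v. mdist (V' (fst v)) (snd v) (\<gamma> (fst v) (\<phi> n (fst v)))) \<in> borel_measurable N)) M'"
    if \<phi>: "pseudometric_dense_sections X V d M \<phi>" for \<phi>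
  proof -
    \<comment> \<open>Uniqueness applied to \<open>M'\<close> itself, which was built from
      \<open>\<phi>0\<close>, with the new sequence \<phi>.\<close>
    have eq: "sets M' = sets (metric_field_algebra X V' (\<lambda>x n. \<gamma> x (\<phi> n x)))"
      by (rule completion_structure_unique[OF X M' assms(2) \<phi>])
    have space_M': "space M' = (SIGMA x:space X. mspace (V' x))"
      by (simp add: M'_def space_metric_field_algebra)
    show ?thesis
      unfolding smallest_sigma_algebra_def
    proof (intro conjI allI impI)
      show "fst \<in> M' \<rightarrow>\<^sub>M X"
        unfolding M'_def by (rule measurable_metric_field_fst)
      show "(\<lambda>v. mdist (V' (fst v)) (snd v) (\<gamma> (fst v) (\<phi> n (fst v)))) \<in> borel_measurable M'" for n
        unfolding measurable_cong_sets[OF eq refl] by (rule measurable_metric_field_dist)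
      show "sets M' \<subseteq> sets N"
        if N: "space N = space M' \<and> fst \<in> N \<rightarrow>\<^sub>M X \<and>
          (\<forall>n. (\<lambda>v. mdist (V' (fst v)) (snd v) (\<gamma> (fst v) (\<phi> n (fst v)))) \<in> borel_measurable N)" for N
        unfolding eq by (rule metric_field_algebra_least) (use N space_M' in simp_all)
    qed
  qed
  show ?thesis
    using M' unique borel_field_polish_completion_structure[OF assms M'] smallest
      measurable_fibrewise_continuous_iff[OF assms M']
    by (intro exI[of _ M'] conjI allI impI) blast+
qed

end
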